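(* The \textsc{Separated-Cluster} problem can be solved in polynomial time on interval graphs; i.e., given an interval graph $G$, a separated-cluster of maximum size can be computed in time polynomial in $|V(G)|$.
   Context: Graphs are finite, simple, undirected. An interval graph is the intersection graph of a family of intervals on the real line. A separated-cluster of $G$ is a set $S\subseteq V(G)$ such that no two vertices of $S$ are at distance exactly $2$ in $G$. *)

theory Defs
  imports
    "HOL-Analysis.Analysis"
    "HOL-Computational_Algebra.Polynomial"
    "Graph_Theory.Pair_Digraph"
    "Graph_Theory.Shortest_Path"
begin

section \<open>Interval graphs and separated clusters\<close>

text \<open>
  A finite simple undirected graph is a \<^locale>\<open>pair_graph\<close>: a finite loop-free digraph with a
  symmetric arc relation. Intervals are arbitrary nonempty intervals (open, closed, half-open,
  possibly unbounded or degenerate).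
\<close>

definition interval_graph :: "'a pair_pre_digraph \<Rightarrow> bool" where
  "interval_graph G \<longleftrightarrow> pair_graph G \<and>
     (\<exists>I :: 'a \<Rightarrow> real set.
        (\<forall>v \<in> pverts G. is_interval (I v) \<and> I v \<noteq> {}) \<and>
        (\<forall>u \<in> pverts G. \<forall>v \<in> pverts G. u \<noteq> v \<longrightarrow>
           ((u, v) \<in> parcs G \<longleftrightarrow> I u \<inter> I v \<noteq> {})))"

text \<open>The distance is infinite for vertices in different components.\<close>

definition graph_dist :: "'a pair_pre_digraph \<Rightarrow> 'a \<Rightarrow> 'a \<Rightarrow> ereal" where
  "graph_dist G u v = wf_digraph.\<mu> (with_proj G) (\<lambda>_. 1) u v"

definition separated_cluster :: "'a pair_pre_digraph \<Rightarrow> 'a set \<Rightarrow> bool" where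
  "separated_cluster G S \<longleftrightarrow>
     S \<subseteq> pverts G \<and> (\<forall>u \<in> S. \<forall>v \<in> S. graph_dist G u v \<noteq> 2)"

definition maximum_separated_cluster :: "'a pair_pre_digraph \<Rightarrow> 'a set \<Rightarrow> bool" where
  "maximum_separated_cluster G S \<longleftrightarrow>
     separated_cluster G S \<and> (\<forall>T. separated_cluster G T \<longrightarrow> card T \<le> card S)"


section \<open>Computation model\<close>

text \<open>
  Structured random access machine programs. A program mentions finitely many arrays of natural
  numbers, indexed by natural numbers; a scalar variable is cell 0 of an array. Arithmetic is
  limited to addition and truncated subtraction. Every node of an evaluated expression and every
  executed command costs one unit. Without multiplication, the bit length of the numbers in
  memory grows only linearly with the time spent, so that polynomial time in this unit-cost model
  coincides with polynomial time on Turing machines.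
\<close>

type_synonym state = "string \<Rightarrow> nat \<Rightarrow> nat"

datatype aexp =
    Lit nat
  | Cell string aexp
  | Add aexp aexp
  | Sub aexp aexp

datatype bexp =
    Less aexp aexp
  | Neg bexp
  | Conj bexp bexp

datatype com =
    Skip
  | Assign string aexp aexp
  | Seq com com
  | Cond bexp com com
  | While bexp com

primrec aval :: "aexp \<Rightarrow> state \<Rightarrow> nat" where
  "aval (Lit k) s = k"
| "aval (Cell x a) s = s x (aval a s)"
| "aval (Add a b) s = aval a s + aval b s"
| "aval (Sub a b) s = aval a s - aval b s"

primrec bval :: "bexp \<Rightarrow> state \<Rightarrow> bool" where
  "bval (Less a b) s \<longleftrightarrow> aval a s < aval b s"
| "bval (Neg b) s \<longleftrightarrow> \<not> bval b s"
| "bval (Conj a b) s \<longleftrightarrow> bval a s \<and> bval b s"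

primrec acost :: "aexp \<Rightarrow> nat" where
  "acost (Lit k) = 1"
| "acost (Cell x a) = 1 + acost a"
| "acost (Add a b) = 1 + acost a + acost b"
| "acost (Sub a b) = 1 + acost a + acost b"

primrec bcost :: "bexp \<Rightarrow> nat" where
  "bcost (Less a b) = 1 + acost a + acost b"
| "bcost (Neg b) = 1 + bcost b"
| "bcost (Conj a b) = 1 + bcost a + bcost b"

text \<open>
  \<open>exec c s t s'\<close>: started in state \<open>s\<close>, program \<open>c\<close> terminates in state \<open>s'\<close> after exactly \<open>t\<close>
  steps. The command \<open>Assign x i a\<close> stores the value of \<open>a\<close> in cell \<open>i\<close> of array \<open>x\<close>.
\<close>

inductive exec :: "com \<Rightarrow> state \<Rightarrow> nat \<Rightarrow> state \<Rightarrow> bool" where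
  Skip: "exec Skip s 1 s"
| Assign: "exec (Assign x i a) s (1 + acost i + acost a) (s(x := (s x)(aval i s := aval a s)))"
| Seq: "exec c s t s' \<Longrightarrow> exec d s' t' s'' \<Longrightarrow> exec (Seq c d) s (1 + t + t') s''"
| CondTrue: "bval b s \<Longrightarrow> exec c s t s' \<Longrightarrow> exec (Cond b c d) s (1 + bcost b + t) s'"
| CondFalse: "\<not> bval b s \<Longrightarrow> exec d s t s' \<Longrightarrow> exec (Cond b c d) s (1 + bcost b + t) s'"
| WhileFalse: "\<not> bval b s \<Longrightarrow> exec (While b c) s (1 + bcost b) s"
| WhileTrue: "bval b s \<Longrightarrow> exec c s t s' \<Longrightarrow> exec (While b c) s' t' s'' \<Longrightarrow>
    exec (While b c) s (1 + bcost b + t + t') s''"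

inductive_cases exec_SkipE: "exec Skip s t s'"
inductive_cases exec_AssignE: "exec (Assign x i a) s t s'"
inductive_cases exec_SeqE: "exec (Seq c d) s t s'"
inductive_cases exec_CondE: "exec (Cond b c d) s t s'"
inductive_cases exec_WhileE: "exec (While b c) s t s'"

lemma exec_deterministic:
  "exec c s t s' \<Longrightarrow> exec c s u s'' \<Longrightarrow> u = t \<and> s'' = s'"
proof (induction arbitrary: u s'' rule: exec.induct)
  case (Skip s)
  then show ?case by (auto elim: exec_SkipE)
next
  case (Assign x i a s)
  then show ?case by (auto elim: exec_AssignE)
next
  case (Seq c s t s' d t' s'')
  from Seq.prems show ?case by (rule exec_SeqE) (auto dest!: Seq.IH)
next
  case (CondTrue b s c t s' d)
  from CondTrue.prems show ?case
    by (rule exec_CondE) (auto simp: CondTrue.hyps dest!: CondTrue.IH)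
next
  case (CondFalse b s d t s' c)
  from CondFalse.prems show ?case
    by (rule exec_CondE) (auto simp: CondFalse.hyps dest!: CondFalse.IH)
next
  case (WhileFalse b s c)
  from WhileFalse.prems show ?case by (rule exec_WhileE) (auto simp: WhileFalse.hyps)
next
  case (WhileTrue b s c t s' t' s'')
  from WhileTrue.prems show ?case
    by (rule exec_WhileE) (auto simp: WhileTrue.hyps dest!: WhileTrue.IH)
qed


section \<open>Encoding of the input and the output\<close>

text \<open>
  For a graph with vertices \<open>0, \<dots>, n - 1\<close>, the input consists of \<open>n\<close> and of the adjacency matrix,
  stored row by row; all other cells are 0. In particular, no interval model is supplied. The
  output is a vertex set, given by its characteristic vector.
\<close>

definition graph_input :: "nat pair_pre_digraph \<Rightarrow> state" where
  "graph_input G = (let n = card (pverts G) in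
     (\<lambda>_ _. 0)
       (''n'' := (\<lambda>_. 0)(0 := n),
        ''adj'' := (\<lambda>k. if k < n * n \<and> (k div n, k mod n) \<in> parcs G then 1 else 0)))"

definition vertex_set_output :: "nat pair_pre_digraph \<Rightarrow> state \<Rightarrow> nat set" where
  "vertex_set_output G s = {v \<in> pverts G. s ''out'' v = 1}"

end

theory Submission
  imports Defs
begin

text \<open>
  A separated cluster is a disjoint union of cliques whose closed neighbourhoods are pairwise
  disjoint. If \<open>a\<close> and \<open>b\<close> are the members of such a clique with the leftmost left and the rightmost
  right endpoint, then its closed neighbourhood is \<open>N[a] \<union> N[b]\<close>, and the clique can be enlarged to a
  maximum clique \<open>K\<close> among the vertices \<open>v\<close> with \<open>N[v] \<subseteq> N[a] \<union> N[b]\<close>. By maximality \<open>K\<close> consists of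
  all such \<open>v\<close> in \<open>N[c] \<inter> N[d]\<close>, where \<open>c\<close> starts last and \<open>d\<close> ends first in \<open>K\<close>. So there are only
  \<open>n\<^sup>4\<close> candidates, all of them found by means of the adjacency relation alone, and a maximum separated
  cluster is a maximum weight independent set in the graph of conflicts between candidates.

  A candidate whose hull ends first is simplicial in the conflict graph, also after other candidates
  are deleted. Hence Frank's local ratio algorithm for chordal graphs applies: repeatedly put a
  simplicial candidate of positive residual weight on a stack and subtract that weight from all
  candidates in conflict with it; then select greedily from the top of the stack. Except for a few
  loops, this algorithm consists of evaluations of arithmetic expressions with bounded sums, which
  are compiled to polynomial-time programs.
\<close>

section \<open>Weighted independent sets by local ratio\<close>

text \<open>No interval model reaches the program, so it cannot ask which endpoint comes first. It
  therefore enumerates all quadruples of vertices, including meaningless ones, which get weight 0,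
  and it finds a simplicial candidate by testing the definition on all pairs. Endpoints occur only
  in the proof that this search succeeds. Optimality is linear programming duality. The amounts
  subtracted bound the weight of every independent set from above, because an independent set
  contains at most one of the positive candidates in conflict with a simplicial one; the greedy
  selection reaches this bound. The exponent of the running time is never optimised. Times and
  values are bounded by powers of one number \<open>X\<close>, at least 2, that bounds the memory;
  constant factors then disappear into the exponent, which depends on the program alone.\<close>

text \<open>
  \<open>a t\<close> is the item in cell \<open>t\<close> of the stack, where \<open>M \<le> a t\<close> means none, \<open>e t\<close> the amount that was
  subtracted for it, and \<open>res t\<close> the residual weights before cell \<open>t\<close> was filled.
\<close>

locale local_ratio =
  fixes M :: nat and w :: "nat \<Rightarrow> nat" and conf :: "nat \<Rightarrow> nat \<Rightarrow> bool"
    and a e :: "nat \<Rightarrow> nat" and res :: "nat \<Rightarrow> nat \<Rightarrow> nat" and good :: "nat \<Rightarrow> nat \<Rightarrow> bool"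
    and sel :: "nat \<Rightarrow> bool"
  assumes conf_sym: "conf i j \<Longrightarrow> conf j i"
    and conf_refl: "i < M \<Longrightarrow> conf i i"
    and simplicial: "P \<subseteq> {j. j < M \<and> 0 < w j} \<Longrightarrow> P \<noteq> {} \<Longrightarrow>
      \<exists>i\<in>P. \<forall>j\<in>P. \<forall>k\<in>P. conf i j \<longrightarrow> conf i k \<longrightarrow> conf j k"
    and res_def: "res t j = w j - (\<Sum>s<t. if conf (a s) j then e s else 0)"
    and good_def: "good t i \<longleftrightarrow> 0 < res t i \<and>
      (\<forall>j<M. \<forall>k<M. 0 < res t j \<longrightarrow> 0 < res t k \<longrightarrow> conf i j \<longrightarrow> conf i k \<longrightarrow> conf j k)"
    and a_good: "t < M \<Longrightarrow> \<exists>i<M. good t i \<Longrightarrow> a t < M \<and> good t (a t)"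
    and e_def: "t < M \<Longrightarrow> e t = (if a t < M then res t (a t) else 0)"
    and a_none: "t < M \<Longrightarrow> \<not> (\<exists>i<M. good t i) \<Longrightarrow> M \<le> a t"
    and sel_def: "p < M \<Longrightarrow> sel p \<longleftrightarrow> 0 < e p \<and> (\<forall>q<M. p < q \<longrightarrow> sel q \<longrightarrow> \<not> conf (a q) (a p))"
begin

lemma res_0: "res 0 j = w j"
  by (simp add: res_def)

lemma res_Suc: "res (Suc t) j = res t j - (if conf (a t) j then e t else 0)"
  by (simp add: res_def)

text \<open>Residual weights only decrease, so the items with positive residual weight run through
  subsets of the initially positive ones. This is why \<open>simplicial\<close> is assumed for every
  nonempty subset \<open>P\<close>.\<close>

lemma good_exists:
  assumes "j < M" "0 < res t j"
  shows "\<exists>i<M. good t i"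
proof -
  let ?P = "{j. j < M \<and> 0 < res t j}"
  have "?P \<subseteq> {j. j < M \<and> 0 < w j}" by (auto simp: res_def)
  moreover have "?P \<noteq> {}" using assms by blast
  ultimately obtain i where "i \<in> ?P" "\<forall>j\<in>?P. \<forall>k\<in>?P. conf i j \<longrightarrow> conf i k \<longrightarrow> conf j k"
    using simplicial by blast
  then show ?thesis unfolding good_def by blast
qed

lemma e_pos:
  assumes "t < M" "0 < e t"
  shows "a t < M" "good t (a t)" "e t = res t (a t)"
  using assms a_good[of t] a_none[of t] e_def[of t] by (auto split: if_splits)

text \<open>While a positive item is left, round \<open>t\<close> finds a good one and subtracts its
  whole residual weight from everything in conflict with it, itself included by
  \<open>conf_refl\<close>. Each such round brings at least one item to 0, so \<open>M\<close>
  rounds suffice.\<close>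

lemma card_positive: "t \<le> M \<Longrightarrow> card {j. j < M \<and> 0 < res t j} \<le> M - t"
proof (induction t)
  case 0
  have "card {j. j < M \<and> 0 < res 0 j} \<le> card {..<M}" by (rule card_mono) auto
  then show ?case by simp
next
  case (Suc t)
  let ?P = "\<lambda>t. {j. j < M \<and> 0 < res t j}"
  show ?case
  proof (cases "?P t = {}")
    case True
    then have empty: "?P (Suc t) = {}" by (auto simp: res_Suc)
    show ?thesis unfolding empty by simp
  next
    case False
    then obtain j where "j < M" "0 < res t j" by blast
    from good_exists[OF this] a_good[of t] Suc.prems have at: "a t < M" "good t (a t)" by auto
    then have pos: "a t \<in> ?P t" by (simp add: good_def)
    have zero: "res (Suc t) (a t) = 0"
      using at e_def[of t] Suc.prems conf_refl by (simp add: res_Suc)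
    have "res (Suc t) j \<le> res t j" for j by (simp add: res_Suc)
    then have "?P (Suc t) \<subseteq> ?P t" using order_less_le_trans by blast
    moreover have "a t \<notin> ?P (Suc t)" using zero by simp
    ultimately have "?P (Suc t) \<subset> ?P t" using pos by blast
    then have "card (?P (Suc t)) < card (?P t)" by (intro psubset_card_mono) auto
    with Suc.IH Suc.prems show ?thesis by linarith
  qed
qed

lemma res_final: "j < M \<Longrightarrow> res M j = 0"
  using card_positive[of M] by auto

text \<open>Weak duality, one round at a time: the items of positive residual weight in conflict
  with a good \<open>a t\<close> are pairwise in conflict, so \<open>I\<close> contains at most one
  of them and loses at most \<open>e t\<close> in round \<open>t\<close>.\<close>

lemma independent_le:
  assumes "I \<subseteq> {..<M}" and ind: "\<And>i j. i \<in> I \<Longrightarrow> j \<in> I \<Longrightarrow> i \<noteq> j \<Longrightarrow> \<not> conf i j"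
  shows "t \<le> M \<Longrightarrow> sum w I \<le> sum e {..<t} + sum (res t) I"
proof (induction t)
  case 0
  then show ?case by (simp add: res_0)
next
  case (Suc t)
  have fin: "finite I" using assms(1) finite_subset by blast
  have "sum (res t) I \<le> e t + sum (res (Suc t)) I"
  proof (cases "\<exists>i\<in>I. conf (a t) i \<and> 0 < res t i \<and> 0 < e t")
    case False
    then have "res t i = res (Suc t) i" if "i \<in> I" for i
      using that by (auto simp: res_Suc)
    then show ?thesis by simp
  next
    case True
    then obtain i where i: "i \<in> I" "conf (a t) i" "0 < res t i" and et: "0 < e t" by blast
    have "good t (a t)" using e_pos(2) et Suc.prems by simp
    have "res t j = res (Suc t) j" if j: "j \<in> I - {i}" for j
    proof (rule ccontr)
      assume "res t j \<noteq> res (Suc t) j"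
      then have "conf (a t) j" "0 < res t j" by (auto simp: res_Suc split: if_splits)
      with \<open>good t (a t)\<close> i j assms(1) have "conf i j" unfolding good_def by blast
      with ind i j show False by blast
    qed
    then have "sum (res t) (I - {i}) = sum (res (Suc t)) (I - {i})" by simp
    moreover have "res t i \<le> e t + res (Suc t) i"
      by (cases "conf (a t) i") (simp_all add: res_Suc)
    ultimately show ?thesis using i fin by (simp add: sum.remove)
  qed
  with Suc show ?case by simp
qed

lemma sel_pos: "p < M \<Longrightarrow> sel p \<Longrightarrow> 0 < e p"
  using sel_def by blast

lemma sel_item: "p < M \<Longrightarrow> sel p \<Longrightarrow> a p < M \<and> 0 < w (a p)"
  using e_pos[of p] sel_pos[of p] by (auto simp: res_def)

lemma sel_independent:
  assumes "p < M" "q < M" "sel p" "sel q" "p \<noteq> q"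
  shows "\<not> conf (a p) (a q)"
  using assms sel_def[of p] sel_def[of q] conf_sym by (metis nat_neq_iff)

lemma sel_inj: "inj_on a {p. p < M \<and> sel p}"
  using sel_independent sel_item conf_refl by (intro inj_onI) (metis mem_Collect_eq)

text \<open>
  The weight of a selected item is the sum of the amounts that were subtracted from it, and every
  amount was subtracted from at least one selected item.
\<close>

lemma sel_weight: "sum e {..<M} \<le> (\<Sum>p | p < M \<and> sel p. w (a p))"
proof -
  let ?S = "{p. p < M \<and> sel p}"
  have w: "w (a p) = (\<Sum>s<M. if s = p \<or> s < p \<and> conf (a s) (a p) then e s else 0)" if "p \<in> ?S" for p
  proof -
    have p: "p < M" "0 < e p" using that sel_pos by auto
    \<comment> \<open>\<open>e p\<close> is the positive residual weight of \<open>a p\<close>, so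
      the truncated subtraction in \<open>res_def\<close> was not cut off at 0.\<close>
    have "w (a p) = e p + (\<Sum>s<p. if conf (a s) (a p) then e s else 0)"
      using e_pos(3)[OF p] p(2) by (simp add: res_def)
    also have "\<dots> = (\<Sum>s\<in>{..p}. if s = p \<or> s < p \<and> conf (a s) (a p) then e s else 0)"
      by (simp add: lessThan_Suc_atMost[symmetric])
    also have "\<dots> = (\<Sum>s<M. if s = p \<or> s < p \<and> conf (a s) (a p) then e s else 0)"
      using p by (intro sum.mono_neutral_left) auto
    finally show ?thesis .
  qed
  have "sum e {..<M} \<le> (\<Sum>s<M. \<Sum>p\<in>?S. if s = p \<or> s < p \<and> conf (a s) (a p) then e s else 0)"
  proof (rule sum_mono)
    fix s assume s: "s \<in> {..<M}"
    show "e s \<le> (\<Sum>p\<in>?S. if s = p \<or> s < p \<and> conf (a s) (a p) then e s else 0)"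
    proof (cases "e s = 0")
      case False
      \<comment> \<open>A cell with a positive amount is rejected only because of a later selected
        cell in conflict with it, and the weight of that cell's item then contains
        \<open>e s\<close>.\<close>
      then have "\<exists>p\<in>?S. s = p \<or> s < p \<and> conf (a s) (a p)"
        using s sel_def[of s] conf_sym by auto
      then obtain p where p: "p \<in> ?S" "s = p \<or> s < p \<and> conf (a s) (a p)" by blast
      have "e s = (if s = p \<or> s < p \<and> conf (a s) (a p) then e s else 0)" using p by simp
      also have "\<dots> \<le> (\<Sum>p\<in>?S. if s = p \<or> s < p \<and> conf (a s) (a p) then e s else 0)"
        using p by (intro member_le_sum) auto
      finally show ?thesis .
    qed simp
  qed
  also have "\<dots> = (\<Sum>p\<in>?S. \<Sum>s<M. if s = p \<or> s < p \<and> conf (a s) (a p) then e s else 0)"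
    by (rule sum.swap)
  also have "\<dots> = (\<Sum>p\<in>?S. w (a p))" using w by simp
  finally show ?thesis .
qed

text \<open>\<open>sum e {..<M}\<close> lies between the two sides: above the left one because no
  residual weight is left after \<open>M\<close> rounds, below the right one by
  \<open>sel_weight\<close>.\<close>

theorem sel_optimal:
  assumes "I \<subseteq> {..<M}" "\<And>i j. i \<in> I \<Longrightarrow> j \<in> I \<Longrightarrow> i \<noteq> j \<Longrightarrow> \<not> conf i j"
  shows "sum w I \<le> (\<Sum>p | p < M \<and> sel p. w (a p))"
proof -
  have "sum (res M) I = 0" using assms(1) res_final by (intro sum.neutral) auto
  with independent_le[OF assms, of M] sel_weight show ?thesis by simp
qed

end

lemma finite_obtain_minimal:
  fixes f :: "'a \<Rightarrow> 'b::linorder"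
  assumes "finite S" "S \<noteq> {}"
  obtains x where "x \<in> S" "\<forall>y\<in>S. f x \<le> f y"
proof -
  have "Min (f ` S) \<in> f ` S" using assms by simp
  then obtain x where "x \<in> S" "f x = Min (f ` S)" by (metis imageE)
  with assms show ?thesis by (intro that[of x]) simp_all
qed

section \<open>Clusters of an interval graph\<close>

text \<open>Nothing is assumed about \<open>cn\<close>, since the program evaluates these notions on
  the adjacency matrix alone. Endpoints enter with \<open>interval_model\<close>.\<close>

locale items =
  fixes n :: nat and cn :: "nat \<Rightarrow> nat \<Rightarrow> bool"
begin

text \<open>\<open>cn\<close> is meant as adjacency or equality. Distance exactly 2 then says that
  \<open>cn\<close> fails although there is a common closed neighbour.\<close>

definition separated :: "nat set \<Rightarrow> bool" where
  "separated S \<longleftrightarrow> S \<subseteq> {..<n} \<and> (\<forall>u\<in>S. \<forall>v\<in>S. cn u v \<or> \<not> (\<exists>x<n. cn u x \<and> cn v x))"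

definition digit :: "nat \<Rightarrow> nat \<Rightarrow> nat" where
  "digit k i = i div n ^ k mod n"

text \<open>
  The item with digits \<open>a, b, c, d\<close> in base \<open>n\<close> stands for the cluster \<open>K = core i\<close>, where \<open>a\<close> and
  \<open>b\<close> carry the leftmost and the rightmost endpoint allowed in \<open>K\<close>, and \<open>c\<close> and \<open>d\<close> the rightmost
  left endpoint and the leftmost right endpoint of \<open>K\<close>.
\<close>

definition reach :: "nat \<Rightarrow> nat \<Rightarrow> bool" where
  "reach i x \<longleftrightarrow> cn (digit 3 i) x \<or> cn (digit 2 i) x"

definition core :: "nat \<Rightarrow> nat \<Rightarrow> bool" where
  "core i v \<longleftrightarrow> (\<forall>x<n. cn v x \<longrightarrow> reach i x) \<and> cn (digit 1 i) v \<and> cn (digit 0 i) v"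

text \<open>Four arbitrary digits need not come from a clique: the intervals of \<open>a\<close> and
  \<open>b\<close> may be disjoint, or \<open>core i\<close> may contain non-adjacent vertices. Such
  items stay in the enumeration and are disabled by weight 0.\<close>

definition valid :: "nat \<Rightarrow> bool" where
  "valid i \<longleftrightarrow> cn (digit 3 i) (digit 2 i) \<and> (\<forall>u<n. \<forall>v<n. core i u \<longrightarrow> core i v \<longrightarrow> cn u v)"

definition weight :: "nat \<Rightarrow> nat" where
  "weight i = (if valid i then card {v. v < n \<and> core i v} else 0)"

definition conflict :: "nat \<Rightarrow> nat \<Rightarrow> bool" where
  "conflict i j \<longleftrightarrow> (\<exists>x<n. reach i x \<and> reach j x)"

lemma digit_less: "0 < n \<Longrightarrow> digit k i < n"
  by (simp add: digit_def)

lemma weight_le: "weight i \<le> n"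
proof -
  have "card {v. v < n \<and> core i v} \<le> card {..<n}" by (rule card_mono) auto
  then show ?thesis by (simp add: weight_def)
qed

end

locale interval_model = items n cn for n :: nat and cn :: "nat \<Rightarrow> nat \<Rightarrow> bool" +
  fixes l r :: "nat \<Rightarrow> real"
  assumes l_le_r: "v < n \<Longrightarrow> l v \<le> r v"
    and cn_iff: "u < n \<Longrightarrow> v < n \<Longrightarrow> cn u v \<longleftrightarrow> l u \<le> r v \<and> l v \<le> r u"
begin

lemma cn_refl: "v < n \<Longrightarrow> cn v v"
  using l_le_r cn_iff by simp

lemma cn_sym: "u < n \<Longrightarrow> v < n \<Longrightarrow> cn u v \<Longrightarrow> cn v u"
  using cn_iff by simp

lemma item_exists:
  assumes "a < n" "b < n" "c < n" "d < n"
  obtains i where "i < n ^ 4" "digit 3 i = a" "digit 2 i = b" "digit 1 i = c" "digit 0 i = d"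
proof -
  define q2 where "q2 = a * n + b"
  define q1 where "q1 = q2 * n + c"
  define i where "i = q1 * n + d"
  have div: "(q * n + x) div n = q" "(q * n + x) mod n = x" if "x < n" for q x
    using that by simp_all
  have less: "q * n + x < m * n" if "q < m" "x < n" for q m x
  proof -
    have "q * n + x < Suc q * n" using that(2) by simp
    also have "\<dots> \<le> m * n" using that(1) by (intro mult_le_mono1) simp
    finally show ?thesis .
  qed
  have "q2 < n * n" unfolding q2_def using assms by (intro less)
  then have "q1 < n * n * n" unfolding q1_def using assms by (intro less)
  then have "i < n * n * n * n" unfolding i_def using assms by (intro less)
  moreover have "n ^ 4 = n * n * n * n" by (simp add: eval_nat_numeral)
  moreover have "i div n = q1" "q1 div n = q2" "q2 div n = a" "i mod n = d" "q1 mod n = c" "q2 mod n = b"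
    unfolding i_def q1_def q2_def using assms by (simp_all only: div)
  moreover have "i div n ^ 3 = i div n div n div n" "i div n ^ 2 = i div n div n"
    by (simp_all add: div_mult2_eq eval_nat_numeral)
  ultimately show ?thesis using assms by (intro that[of i]) (simp_all add: digit_def)
qed

section \<open>Conflicts between items in terms of their hulls\<close>

lemma conflict_sym: "conflict i j \<Longrightarrow> conflict j i"
  unfolding conflict_def by blast

lemma conflict_refl: "0 < n \<Longrightarrow> conflict i i"
  unfolding conflict_def reach_def using digit_less cn_refl by blast

definition hull_left :: "nat \<Rightarrow> real" where "hull_left i = min (l (digit 3 i)) (l (digit 2 i))"
definition hull_right :: "nat \<Rightarrow> real" where "hull_right i = max (r (digit 3 i)) (r (digit 2 i))"

text \<open>If the intervals of the two leading digits meet, their union has no gap, so meeting one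
  of them is the same as meeting the hull.\<close>

lemma reach_iff:
  assumes "0 < n" "cn (digit 3 i) (digit 2 i)" "x < n"
  shows "reach i x \<longleftrightarrow> l x \<le> hull_right i \<and> hull_left i \<le> r x"
proof -
  have d: "digit 3 i < n" "digit 2 i < n" using digit_less assms(1) by auto
  show ?thesis
    using assms(2) cn_iff[OF d] cn_iff[OF d(1) assms(3)] cn_iff[OF d(2) assms(3)]
      l_le_r[OF d(1)] l_le_r[OF d(2)] l_le_r[OF assms(3)]
    unfolding reach_def hull_left_def hull_right_def by linarith
qed

text \<open>Disjoint hulls may still conflict through a vertex that meets both, so intersecting the
  hulls is not enough. Take \<open>i\<close> with the hull that ends first, and witnesses
  \<open>u\<close> and \<open>v\<close> of its conflicts with \<open>j\<close> and \<open>k\<close>.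
  Both start before every hull in \<open>P\<close> ends. If the hull of \<open>k\<close> starts no
  later than that of \<open>j\<close>, then \<open>u\<close>, which extends to the start of
  \<open>j\<close>, also meets \<open>k\<close>; otherwise \<open>v\<close> meets
  \<open>j\<close>.\<close>

lemma conflict_simplicial:
  assumes P: "P \<subseteq> {j. j < M \<and> 0 < weight j}" "P \<noteq> {}"
  shows "\<exists>i\<in>P. \<forall>j\<in>P. \<forall>k\<in>P. conflict i j \<longrightarrow> conflict i k \<longrightarrow> conflict j k"
proof -
  have "finite P" using P(1) by (rule finite_subset) simp
  then obtain i where i: "i \<in> P" "\<And>j. j \<in> P \<Longrightarrow> hull_right i \<le> hull_right j"
    using P(2) by (rule finite_obtain_minimal[where f = hull_right]) blast
  have n: "0 < n" using i(1) P(1) weight_le[of i] by auto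
  have meet: "cn (digit 3 j) (digit 2 j)" if "j \<in> P" for j
  proof -
    have "0 < weight j" using that P(1) by blast
    then have "valid j" unfolding weight_def by (simp split: if_splits)
    then show ?thesis by (simp add: valid_def)
  qed
  have "conflict j k" if jk: "j \<in> P" "k \<in> P" and ijk: "conflict i j" "conflict i k" for j k
  proof -
    note iff = reach_iff[OF n meet]
    obtain u v where u: "u < n" "reach i u" "reach j u" and v: "v < n" "reach i v" "reach k v"
      using ijk unfolding conflict_def by blast
    have "l u \<le> hull_right i" "hull_left j \<le> r u" "l v \<le> hull_right i" "hull_left k \<le> r v" "hull_right i \<le> hull_right j" "hull_right i \<le> hull_right k"
      using iff u v i(1) jk i(2) by auto
    moreover have "reach k u \<or> reach j v"
    proof (cases "hull_left k \<le> hull_left j")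
      case True
      then have "hull_left k \<le> r u" using calculation by linarith
      then have "reach k u" using iff[OF jk(2) u(1)] calculation by linarith
      then show ?thesis ..
    next
      case False
      then have "hull_left j \<le> r v" using calculation by linarith
      then have "reach j v" using iff[OF jk(1) v(1)] calculation by linarith
      then show ?thesis ..
    qed
    ultimately show ?thesis using u v unfolding conflict_def by blast
  qed
  with i(1) show ?thesis by blast
qed

section \<open>Correspondence between independent sets of items and separated clusters\<close>

lemma core_reach: "v < n \<Longrightarrow> core i v \<Longrightarrow> reach i v"
  unfolding core_def using cn_refl by blast

text \<open>All closed neighbours of a core vertex are reached by its item, so a common neighbour of
  vertices from two cores would be a conflict.\<close>

lemma union_separated:
  assumes valid: "\<And>i. i \<in> I \<Longrightarrow> valid i"
    and ind: "\<And>i j. i \<in> I \<Longrightarrow> j \<in> I \<Longrightarrow> i \<noteq> j \<Longrightarrow> \<not> conflict i j"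
  shows "separated {v. v < n \<and> (\<exists>i\<in>I. core i v)}"
  unfolding separated_def
proof (intro conjI ballI)
  fix u v assume "u \<in> {v. v < n \<and> (\<exists>i\<in>I. core i v)}" "v \<in> {v. v < n \<and> (\<exists>i\<in>I. core i v)}"
  then obtain i j where i: "u < n" "i \<in> I" "core i u" and j: "v < n" "j \<in> I" "core j v" by blast
  show "cn u v \<or> \<not> (\<exists>x<n. cn u x \<and> cn v x)"
  proof (cases "i = j")
    case True
    then show ?thesis using valid[OF i(2)] i j unfolding valid_def by blast
  next
    case False
    then have "\<not> conflict i j" using ind i j by blast
    then show ?thesis using i(3) j(3) unfolding conflict_def core_def by blast
  qed
qed auto

text \<open>Cores of items without conflict are disjoint because each item reaches its own
  core.\<close>

lemma union_card:
  assumes "finite I" and valid: "\<And>i. i \<in> I \<Longrightarrow> valid i"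
    and ind: "\<And>i j. i \<in> I \<Longrightarrow> j \<in> I \<Longrightarrow> i \<noteq> j \<Longrightarrow> \<not> conflict i j"
  shows "card {v. v < n \<and> (\<exists>i\<in>I. core i v)} = sum weight I"
proof -
  have "{v. v < n \<and> (\<exists>i\<in>I. core i v)} = (\<Union>i\<in>I. {v. v < n \<and> core i v})" by blast
  also have "card \<dots> = (\<Sum>i\<in>I. card {v. v < n \<and> core i v})"
  proof (rule card_UN_disjoint[OF assms(1)])
    show "\<forall>i\<in>I. \<forall>j\<in>I. i \<noteq> j \<longrightarrow> {v. v < n \<and> core i v} \<inter> {v. v < n \<and> core j v} = {}"
      using ind core_reach unfolding conflict_def by blast
  qed simp
  also have "\<dots> = sum weight I" using valid by (simp add: weight_def)
  finally show ?thesis .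
qed

text \<open>\<open>C\<close> competes in the choice of the maximum clique \<open>K\<close>, so
  replacing \<open>C\<close> by \<open>K\<close> loses nothing. The last conclusion confines
  \<open>reach i\<close> to the closed neighbourhood of \<open>C\<close>; this keeps the items of
  different cliques free of conflicts.\<close>

lemma clique_item:
  assumes C: "C \<subseteq> {..<n}" "C \<noteq> {}" "\<And>u v. u \<in> C \<Longrightarrow> v \<in> C \<Longrightarrow> cn u v"
  obtains i where "i < n ^ 4" "card C \<le> weight i" "\<And>x. x < n \<Longrightarrow> reach i x \<Longrightarrow> \<exists>a\<in>C. cn a x"
proof -
  have fin: "finite C" using C(1) finite_subset by blast
  obtain a where a: "a \<in> C" "\<And>v. v \<in> C \<Longrightarrow> l a \<le> l v"
    by (rule finite_obtain_minimal[OF fin C(2), of l]) blast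
  obtain b where b: "b \<in> C" "\<And>v. v \<in> C \<Longrightarrow> r v \<le> r b"
    by (rule finite_obtain_minimal[OF fin C(2), of "\<lambda>v. - r v"]) auto
  let ?A = "{v. v < n \<and> (\<forall>x<n. cn v x \<longrightarrow> cn a x \<or> cn b x)}"
  let ?Q = "\<lambda>K. K \<subseteq> ?A \<and> (\<forall>u\<in>K. \<forall>v\<in>K. cn u v)"
  have ab: "a < n" "b < n" "cn a b" using a b C by auto
  have "C \<subseteq> ?A"
  proof
    fix v assume v: "v \<in> C"
    then have "v < n" using C(1) by blast
    moreover have "cn a x \<or> cn b x" if "x < n" "cn v x" for x
      using that a(2)[OF v] b(2)[OF v] ab \<open>v < n\<close> cn_iff l_le_r[of x] by (smt (verit))
    ultimately show "v \<in> ?A" by blast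
  qed
  then have QC: "?Q C" using C(3) by blast
  have finA: "finite ?A" by simp
  have "finite {K. ?Q K}" by (rule finite_subset[of _ "Pow ?A"]) auto
  moreover have "{K. ?Q K} \<noteq> {}" using QC by blast
  ultimately obtain K where "K \<in> {K. ?Q K}" "\<forall>K'\<in>{K. ?Q K}. - int (card K) \<le> - int (card K')"
    by (rule finite_obtain_minimal[where f = "\<lambda>K. - int (card K)"])
  then have K: "?Q K" "\<And>K'. ?Q K' \<Longrightarrow> card K' \<le> card K" by simp_all
  have cK: "card C \<le> card K" using K(2) QC by blast
  have finK: "finite K" using K(1) finA finite_subset by blast
  have "card C > 0" using fin C(2) by (simp add: card_gt_0_iff)
  then have "K \<noteq> {}" using cK by auto
  obtain c where c: "c \<in> K" "\<And>v. v \<in> K \<Longrightarrow> l v \<le> l c"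
    by (rule finite_obtain_minimal[OF finK \<open>K \<noteq> {}\<close>, of "\<lambda>v. - l v"]) auto
  obtain d where d: "d \<in> K" "\<And>v. v \<in> K \<Longrightarrow> r d \<le> r v"
    by (rule finite_obtain_minimal[OF finK \<open>K \<noteq> {}\<close>, of r]) blast
  have Kn: "v < n" if "v \<in> K" for v using K(1) that by blast
  obtain i where i: "i < n ^ 4" "digit 3 i = a" "digit 2 i = b" "digit 1 i = c" "digit 0 i = d"
    using item_exists[of a b c d] ab c(1) d(1) Kn by metis
  have reach: "reach i x \<longleftrightarrow> cn a x \<or> cn b x" for x by (simp add: reach_def i)
  have coreK: "{v. v < n \<and> core i v} = K"
  proof (intro set_eqI iffI)
    fix v assume "v \<in> K"
    then show "v \<in> {v. v < n \<and> core i v}"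
      using K(1) c(1) d(1) unfolding core_def reach i by blast
  next
    fix v assume "v \<in> {v. v < n \<and> core i v}"
    then have v: "v \<in> ?A" "v < n" "cn c v" "cn d v" unfolding core_def reach i by blast+
    \<comment> \<open>Meeting \<open>c\<close> makes \<open>v\<close> end no earlier than the last
      start in \<open>K\<close>, and meeting \<open>d\<close> makes it start no later than the first
      end in \<open>K\<close>; so \<open>v\<close> meets every member of \<open>K\<close>.\<close>
    have "cn v u \<and> cn u v" if u: "u \<in> K" for u
    proof -
      have "l u \<le> l c" "r d \<le> r u" "l c \<le> r v" "l v \<le> r d"
        using c(2)[OF u] d(2)[OF u] v Kn[OF c(1)] Kn[OF d(1)] cn_iff by auto
      then have "l u \<le> r v" "l v \<le> r u" by linarith+
      then show ?thesis using cn_iff v(2) Kn[OF u] by blast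
    qed
    then have "?Q (insert v K)" using K(1) v(1,2) cn_refl by blast
    then have "card (insert v K) \<le> card K" using K(2) by blast
    then show "v \<in> K" using finK by (metis card_insert_disjoint not_less_eq_eq order_refl)
  qed
  have "valid i" unfolding valid_def
  proof (intro conjI allI impI)
    show "cn (digit 3 i) (digit 2 i)" using ab(3) i by simp
    fix u v assume "u < n" "v < n" "core i u" "core i v"
    then have "u \<in> K" "v \<in> K" using coreK by blast+
    then show "cn u v" using K(1) by blast
  qed
  then have "weight i = card K" by (simp add: weight_def coreK)
  then show ?thesis using that[of i] i(1) cK reach a(1) b(1) by metis
qed

text \<open>On a separated set \<open>cn\<close> is an equivalence relation whose classes are
  cliques. Each class is replaced by an item from \<open>clique_item\<close>. If two such items
  conflict, members of the two classes share a closed neighbour, and separation makes the classes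
  equal.\<close>

lemma separated_items:
  assumes T: "separated T"
  obtains I where "I \<subseteq> {..<n ^ 4}" "card T \<le> sum weight I"
    "\<And>i j. i \<in> I \<Longrightarrow> j \<in> I \<Longrightarrow> i \<noteq> j \<Longrightarrow> \<not> conflict i j"
proof -
  have Tn: "v < n" if "v \<in> T" for v using T that unfolding separated_def by blast
  have fin: "finite T" using Tn by (intro finite_subset[of T "{..<n}"]) auto
  have trans: "cn u v" if "u \<in> T" "v \<in> T" "x < n" "cn u x" "cn v x" for u v x
    using T that unfolding separated_def by blast
  let ?C = "\<lambda>v. {u \<in> T. cn v u}"
  have C_eq: "?C u = ?C v" if "u \<in> T" "v \<in> T" "cn u v" for u v
  proof -
    have sym: "cn y x" if "x \<in> T" "y \<in> T" "cn x y" for x y using that Tn cn_sym by blast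
    have "cn y w" if "x \<in> T" "y \<in> T" "w \<in> T" "cn x y" "cn x w" for x y w
      using trans[of y w x] sym[OF that(1,2,4)] sym[OF that(1,3,5)] that Tn by blast
    with sym[OF that] that show ?thesis by blast
  qed
  have "\<exists>i. i < n ^ 4 \<and> card C \<le> weight i \<and> (\<forall>x<n. reach i x \<longrightarrow> (\<exists>a\<in>C. cn a x))"
    if C: "C \<in> ?C ` T" for C
  proof -
    obtain v where v: "v \<in> T" "C = ?C v" using C by blast
    show ?thesis
    proof (rule clique_item[of C])
      show "C \<subseteq> {..<n}" "C \<noteq> {}" using v Tn cn_refl by auto
      show "cn u w" if "u \<in> C" "w \<in> C" for u w
        using that v trans[of u w v] Tn cn_sym by blast
    qed blast
  qed
  then obtain g where g: "\<And>C. C \<in> ?C ` T \<Longrightarrow> g C < n ^ 4 \<and> card C \<le> weight (g C) \<and>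
      (\<forall>x<n. reach (g C) x \<longrightarrow> (\<exists>a\<in>C. cn a x))"
    by metis
  \<comment> \<open>The item is chosen per class and not per vertex; hence equal classes give equal
    items.\<close>
  define f where "f v = g (?C v)" for v
  have f: "f v < n ^ 4" "card (?C v) \<le> weight (f v)"
    "\<And>x. x < n \<Longrightarrow> reach (f v) x \<Longrightarrow> \<exists>a\<in>T. cn v a \<and> cn a x" if "v \<in> T" for v
    using g[of "?C v"] that by (auto simp: f_def)
  have conf: "?C u = ?C v" if uv: "u \<in> T" "v \<in> T" "conflict (f u) (f v)" for u v
  proof -
    obtain x where x: "x < n" "reach (f u) x" "reach (f v) x"
      using uv(3) unfolding conflict_def by blast
    obtain a b where "a \<in> T" "cn u a" "cn a x" "b \<in> T" "cn v b" "cn b x"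
      using f(3)[OF uv(1) x(1,2)] f(3)[OF uv(2) x(1,3)] by blast
    note ab = this
    have "cn a b" by (rule trans[OF ab(1,4) x(1) ab(3,6)])
    then have "?C u = ?C a" "?C a = ?C b" "?C v = ?C b"
      using C_eq[OF uv(1) ab(1,2)] C_eq[OF ab(1,4)] C_eq[OF uv(2) ab(4,5)] by simp_all
    then show ?thesis by simp
  qed
  have n: "0 < n" if "v \<in> T" for v using Tn[OF that] by simp
  show ?thesis
  proof (rule that[of "f ` T"])
    show "f ` T \<subseteq> {..<n ^ 4}" using f(1) by blast
    show "\<not> conflict i j" if ij: "i \<in> f ` T" "j \<in> f ` T" "i \<noteq> j" for i j
    proof
      assume c: "conflict i j"
      obtain u v where uv: "u \<in> T" "v \<in> T" "i = f u" "j = f v" using ij by blast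
      with c conf have "?C u = ?C v" by blast
      then have "i = j" unfolding uv(3,4) f_def by (rule arg_cong)
      with ij(3) show False ..
    qed
    have "T = (\<Union>i\<in>f ` T. {u \<in> T. f u = i})" by blast
    then have "card T \<le> (\<Sum>i\<in>f ` T. card {u \<in> T. f u = i})"
      using card_UN_le[of "f ` T" "\<lambda>i. {u \<in> T. f u = i}"] fin by simp
    also have "\<dots> \<le> sum weight (f ` T)"
    proof (rule sum_mono)
      fix i assume "i \<in> f ` T"
      then obtain v where v: "v \<in> T" "i = f v" by blast
      have "{u \<in> T. f u = i} \<subseteq> ?C v"
      proof
        fix u assume "u \<in> {u \<in> T. f u = i}"
        then have u: "u \<in> T" "f u = f v" using v by auto
        \<comment> \<open>An item conflicts with itself, so \<open>conf\<close> also shows that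
          different classes never share an item. Each weight therefore pays for a single
          class.\<close>
        then have "?C u = ?C v" using conf[OF u(1) v(1)] conflict_refl n by simp
        then show "u \<in> ?C v" using u(1) cn_refl Tn by blast
      qed
      then have "card {u \<in> T. f u = i} \<le> card (?C v)" using fin by (intro card_mono) auto
      also have "\<dots> \<le> weight i" using f(2) v by simp
      finally show "card {u \<in> T. f u = i} \<le> weight i" .
    qed
    finally show "card T \<le> sum weight (f ` T)" .
  qed
qed

text \<open>Selected items have positive weight and are therefore valid, so their weights are the
  sizes of their cores and \<open>sel_optimal\<close> compares cardinalities.\<close>

theorem selection_maximum:
  assumes "local_ratio (n ^ 4) weight conflict a e res good sel"
  defines "S \<equiv> {v. v < n \<and> (\<exists>p<n ^ 4. sel p \<and> core (a p) v)}"
  shows "separated S" "separated T \<Longrightarrow> card T \<le> card S"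
proof -
  interpret local_ratio "n ^ 4" weight conflict a e res good sel by fact
  define I where "I = a ` {p. p < n ^ 4 \<and> sel p}"
  have S: "S = {v. v < n \<and> (\<exists>i\<in>I. core i v)}" unfolding S_def I_def by blast
  have valid: "valid i" if "i \<in> I" for i
  proof -
    have "0 < weight i" using that sel_item unfolding I_def by blast
    then show ?thesis unfolding weight_def by (simp split: if_splits)
  qed
  have ind: "\<not> conflict i j" if "i \<in> I" "j \<in> I" "i \<noteq> j" for i j
    using that sel_independent unfolding I_def by blast
  have "finite I" by (simp add: I_def)
  show "separated S" unfolding S by (rule union_separated[OF valid ind])
  assume "separated T"
  then obtain J where J: "J \<subseteq> {..<n ^ 4}" "card T \<le> sum weight J"
    "\<And>i j. i \<in> J \<Longrightarrow> j \<in> J \<Longrightarrow> i \<noteq> j \<Longrightarrow> \<not> conflict i j"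
    by (rule separated_items) blast
  have "sum weight J \<le> sum weight I"
    using sel_optimal[OF J(1,3)] sel_inj by (simp add: I_def sum.reindex)
  also have "\<dots> = card S" unfolding S by (rule union_card[OF \<open>finite I\<close> valid ind, symmetric])
  finally show "card T \<le> card S" using J(2) by simp
qed

end

section \<open>Expressions with bounded sums\<close>

text \<open>The invariant carries the number of completed rounds, which fixes the number of rounds
  at \<open>K\<close>. The final failing test is charged like a full round, so the bound is a single
  product.\<close>

lemma while_count:
  assumes "\<And>k s. k < K \<Longrightarrow> I k s \<Longrightarrow>
      bval b s \<and> (\<exists>t s'. exec c s t s' \<and> t \<le> T \<and> I (Suc k) s')"
    and "\<And>s. I K s \<Longrightarrow> \<not> bval b s"
    and "I 0 s"
  shows "\<exists>t s'. exec (While b c) s t s' \<and> t \<le> (K + 1) * (T + 1 + bcost b) \<and> I K s'"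
proof -
  have "k \<le> K \<Longrightarrow> I k s \<Longrightarrow> \<exists>t s'. exec (While b c) s t s' \<and>
      t \<le> (K - k + 1) * (T + 1 + bcost b) \<and> I K s'" for k s
  proof (induction "K - k" arbitrary: k s)
    case 0
    then have "I K s" by simp
    with assms(2) have "exec (While b c) s (1 + bcost b) s"
      by (intro exec.WhileFalse) auto
    with \<open>I K s\<close> 0 show ?case by (intro exI[of _ "1 + bcost b"] exI[of _ s]) auto
  next
    case (Suc d)
    then have "k < K" by simp
    with assms(1) Suc.prems obtain t s' where 1: "bval b s" "exec c s t s'" "t \<le> T" "I (Suc k) s'"
      by blast
    have "d = K - Suc k" "Suc k \<le> K" using Suc.hyps(2) by simp_all
    from Suc.hyps(1)[OF this 1(4)] obtain t' s''
      where 2: "exec (While b c) s' t' s''" "t' \<le> (K - Suc k + 1) * (T + 1 + bcost b)" "I K s''"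
      by blast
    have "exec (While b c) s (1 + bcost b + t + t') s''"
      using 1 2 by (intro exec.WhileTrue) auto
    moreover have "1 + bcost b + t + t' \<le> (K - k + 1) * (T + 1 + bcost b)"
    proof -
      have "K - k + 1 = Suc (K - Suc k + 1)" using \<open>k < K\<close> by simp
      then have "(K - k + 1) * (T + 1 + bcost b) =
        (T + 1 + bcost b) + (K - Suc k + 1) * (T + 1 + bcost b)" by (metis mult_Suc)
      with 1(3) 2(2) show ?thesis by linarith
    qed
    ultimately show ?case using 2(3) by blast
  qed
  from this[of 0 s] assms(3) show ?thesis by simp
qed

text \<open>The bounded sum is the only looping construct. It supplies multiplication, quantifiers
  and counting, and its nesting depth is fixed by the expression, which keeps evaluation
  polynomial.\<close>

datatype xexp =
    XLit nat
  | XVar nat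
  | XCell string xexp
  | XAdd xexp xexp
  | XSub xexp xexp
  | XLess xexp xexp
  | XSum nat xexp xexp

primrec xval :: "xexp \<Rightarrow> state \<Rightarrow> (nat \<Rightarrow> nat) \<Rightarrow> nat" where
  "xval (XLit c) s \<rho> = c"
| "xval (XVar v) s \<rho> = \<rho> v"
| "xval (XCell x e) s \<rho> = s x (xval e s \<rho>)"
| "xval (XAdd a b) s \<rho> = xval a s \<rho> + xval b s \<rho>"
| "xval (XSub a b) s \<rho> = xval a s \<rho> - xval b s \<rho>"
| "xval (XLess a b) s \<rho> = of_bool (xval a s \<rho> < xval b s \<rho>)"
| "xval (XSum v a b) s \<rho> = (\<Sum>i<xval a s \<rho>. xval b s (\<rho>(v := i)))"

text \<open>Reserves \<open>''t''\<close> and \<open>''v''\<close> for compiled code, so that its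
  scratch work cannot change the value of an expression.\<close>

primrec wfx :: "xexp \<Rightarrow> bool" where
  "wfx (XLit c) \<longleftrightarrow> True"
| "wfx (XVar v) \<longleftrightarrow> True"
| "wfx (XCell x e) \<longleftrightarrow> x \<noteq> ''t'' \<and> x \<noteq> ''v'' \<and> wfx e"
| "wfx (XAdd a b) \<longleftrightarrow> wfx a \<and> wfx b"
| "wfx (XSub a b) \<longleftrightarrow> wfx a \<and> wfx b"
| "wfx (XLess a b) \<longleftrightarrow> wfx a \<and> wfx b"
| "wfx (XSum v a b) \<longleftrightarrow> wfx a \<and> wfx b"

lemma xval_cong:
  "wfx e \<Longrightarrow> (\<And>x. x \<noteq> ''t'' \<Longrightarrow> x \<noteq> ''v'' \<Longrightarrow> s x = s' x) \<Longrightarrow> xval e s \<rho> = xval e s' \<rho>"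
  by (induction e arbitrary: \<rho>) auto

text \<open>
  Variable \<open>v\<close> lives in cell \<open>v\<close> of array \<open>''v''\<close>; array \<open>''t''\<close> is a stack of intermediate results,
  of which \<open>compile e k\<close> uses the cells from \<open>k\<close> on, leaving the value of \<open>e\<close> in cell \<open>k\<close>. The code of
  a sum restores its summation variable, so that nested sums may reuse a name.
\<close>

abbreviation "tmp k \<equiv> Cell ''t'' (Lit k)"
abbreviation "var v \<equiv> Cell ''v'' (Lit v)"
abbreviation "set_tmp k \<equiv> Assign ''t'' (Lit k)"
abbreviation "set_var v \<equiv> Assign ''v'' (Lit v)"

primrec compile :: "xexp \<Rightarrow> nat \<Rightarrow> com" where
  "compile (XLit c) k = set_tmp k (Lit c)"
| "compile (XVar v) k = set_tmp k (var v)"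
| "compile (XCell x e) k = Seq (compile e k) (set_tmp k (Cell x (tmp k)))"
| "compile (XAdd a b) k = Seq (compile a k) (Seq (compile b (Suc k))
     (set_tmp k (Add (tmp k) (tmp (Suc k)))))"
| "compile (XSub a b) k = Seq (compile a k) (Seq (compile b (Suc k))
     (set_tmp k (Sub (tmp k) (tmp (Suc k)))))"
| "compile (XLess a b) k = Seq (compile a k) (Seq (compile b (Suc k))
     (Cond (Less (tmp k) (tmp (Suc k))) (set_tmp k (Lit 1)) (set_tmp k (Lit 0))))"
| "compile (XSum v a b) k = Seq (compile a k) (Seq (set_tmp (k + 1) (Lit 0))
     (Seq (set_tmp (k + 2) (var v)) (Seq (set_var v (Lit 0))
     (Seq (While (Less (var v) (tmp k))
       (Seq (compile b (k + 3)) (Seq (set_tmp (k + 1) (Add (tmp (k + 1)) (tmp (k + 3))))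
         (set_var v (Add (var v) (Lit 1))))))
     (Seq (set_var v (tmp (k + 2))) (set_tmp k (tmp (k + 1))))))))"

section \<open>Polynomial running time of compiled expressions\<close>

definition bounded_state :: "nat \<Rightarrow> state \<Rightarrow> bool" where
  "bounded_state X s \<longleftrightarrow> (\<forall>x i. x \<noteq> ''t'' \<longrightarrow> s x i \<le> X)"

definition computes :: "nat \<Rightarrow> com \<Rightarrow> nat \<Rightarrow> state \<Rightarrow> nat \<Rightarrow> bool" where
  "computes T c k s r \<longleftrightarrow> (\<exists>t s'. exec c s t s' \<and> t \<le> T \<and> (\<forall>x. x \<noteq> ''t'' \<longrightarrow> s' x = s x) \<and>
     (\<forall>i<k. s' ''t'' i = s ''t'' i) \<and> s' ''t'' k = r)"

lemma computesI:
  assumes "exec c s t s'" "t \<le> T" "\<And>x. x \<noteq> ''t'' \<Longrightarrow> s' x = s x"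
    "\<And>i. i < k \<Longrightarrow> s' ''t'' i = s ''t'' i" "s' ''t'' k = r"
  shows "computes T c k s r"
  using assms unfolding computes_def by blast

text \<open>The value is bounded along with the time because it may serve as the length of a sum. It
  may exceed \<open>X\<close>, which is why \<open>bounded_state\<close> exempts the stack
  \<open>''t''\<close>.\<close>

definition poly_computed :: "xexp \<Rightarrow> nat \<Rightarrow> bool" where
  "poly_computed e c \<longleftrightarrow> (\<forall>X s k. 2 \<le> X \<longrightarrow> bounded_state X s \<longrightarrow>
     xval e s (s ''v'') \<le> X ^ c \<and> computes (X ^ c) (compile e k) k s (xval e s (s ''v'')))"

lemma bounded_state_cong:
  "bounded_state X s \<Longrightarrow> (\<And>x. x \<noteq> ''t'' \<Longrightarrow> s' x = s x) \<Longrightarrow> bounded_state X s'"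
  by (simp add: bounded_state_def)

lemma bounded_stateD: "bounded_state X s \<Longrightarrow> x \<noteq> ''t'' \<Longrightarrow> s x i \<le> X"
  by (simp add: bounded_state_def)

lemma xval_cong_tmp:
  "wfx e \<Longrightarrow> (\<And>x. x \<noteq> ''t'' \<Longrightarrow> s' x = s x) \<Longrightarrow> xval e s' \<rho> = xval e s \<rho>"
  by (rule xval_cong) auto

lemma small_le_power: "2 \<le> X \<Longrightarrow> m \<le> 2 ^ c \<Longrightarrow> m \<le> (X::nat) ^ c"
  by (meson order_trans power_mono zero_le)

lemma exec_binary:
  assumes a: "poly_computed a ca" and b: "poly_computed b cb" and wf: "wfx a" "wfx b"
    and X: "2 \<le> X" "bounded_state X s"
  obtains t t' s' s'' where "exec (compile a k) s t s'" "exec (compile b (Suc k)) s' t' s''"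
    "t \<le> X ^ ca" "t' \<le> X ^ cb" "\<forall>x. x \<noteq> ''t'' \<longrightarrow> s'' x = s x"
    "\<forall>i<k. s'' ''t'' i = s ''t'' i" "s'' ''t'' k = xval a s (s ''v'')"
    "s'' ''t'' (Suc k) = xval b s (s ''v'')"
    "xval a s (s ''v'') \<le> X ^ ca" "xval b s (s ''v'') \<le> X ^ cb"
proof -
  from a X obtain t s' where 1: "exec (compile a k) s t s'" "t \<le> X ^ ca"
      "\<And>x. x \<noteq> ''t'' \<Longrightarrow> s' x = s x" "\<And>i. i < k \<Longrightarrow> s' ''t'' i = s ''t'' i"
      "s' ''t'' k = xval a s (s ''v'')" "xval a s (s ''v'') \<le> X ^ ca"
    unfolding poly_computed_def computes_def by blast
  have X': "bounded_state X s'" using X(2) 1(3) by (rule bounded_state_cong)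
  have eq: "xval b s' (s' ''v'') = xval b s (s ''v'')"
    using xval_cong_tmp[OF wf(2) 1(3)] 1(3) by simp
  from b X(1) X' obtain t' s'' where 2: "exec (compile b (Suc k)) s' t' s''" "t' \<le> X ^ cb"
      "\<And>x. x \<noteq> ''t'' \<Longrightarrow> s'' x = s' x" "\<And>i. i < Suc k \<Longrightarrow> s'' ''t'' i = s' ''t'' i"
      "s'' ''t'' (Suc k) = xval b s (s ''v'')" "xval b s (s ''v'') \<le> X ^ cb"
    unfolding poly_computed_def computes_def eq[symmetric] by blast
  show ?thesis by (rule that[OF 1(1) 2(1)]) (use 1 2 in auto)
qed

text \<open>In the exponent, 5 pays for the overhead \<open>m\<close> and 2 for adding up three
  terms, as three is at most \<open>2 ^ 2\<close>.\<close>

lemma binary_time: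
  assumes "2 \<le> X" "t \<le> X ^ ca" "t' \<le> (X::nat) ^ cb" "m \<le> 2 ^ 5"
  shows "t + t' + m \<le> X ^ (ca + cb + 7)"
proof -
  let ?d = "ca + cb + 5"
  have "t \<le> X ^ ?d" "t' \<le> X ^ ?d" "m \<le> X ^ ?d"
    using assms small_le_power[OF assms(1,4)]
    by (auto intro: order_trans[OF _ power_increasing])
  then have "t + t' + m \<le> 2 ^ 2 * X ^ ?d" by simp
  also have "\<dots> \<le> X ^ 2 * X ^ ?d" using assms(1) by (intro mult_mono power_mono) auto
  also have "\<dots> = X ^ (ca + cb + 7)" by (simp add: ac_simps flip: power_add)
  finally show ?thesis .
qed

text \<open>The summand runs while the variable \<open>v\<close> may be as large as
  \<open>X ^ ca\<close>, so its bound is applied with \<open>X ^ (ca + 1)\<close> in the role of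
  \<open>X\<close>, and the exponents multiply to \<open>d\<close>. The extra 1 keeps the other
  cells, bounded by \<open>X\<close>, below this number even if \<open>ca\<close> is 0.\<close>

lemma poly_computed_XSum:
  assumes a: "poly_computed a ca" and b: "poly_computed b cb" and wf: "wfx a" "wfx b"
  shows "\<exists>c. poly_computed (XSum v a b) c"
proof -
  define d where "d = (ca + 1) * cb"
  \<comment> \<open>With \<open>p = X ^ (ca + d + 5)\<close> the loop takes at most
    \<open>4 * (p * p)\<close> steps and the whole code at most \<open>16 * (p * p)\<close>; the
    factor 16 becomes \<open>X ^ 4\<close>.\<close>
  define c where "c = 2 * (ca + d + 5) + 4"
  have "xval (XSum v a b) s (s ''v'') \<le> X ^ c \<and>
      computes (X ^ c) (compile (XSum v a b) k) k s (xval (XSum v a b) s (s ''v''))"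
    if X: "2 \<le> X" "bounded_state X s" for X s k
  proof -
    let ?N = "xval a s (s ''v'')"
    let ?Y = "X ^ (ca + 1)"
    let ?b = "\<lambda>i. xval b s ((s ''v'')(v := i))"
    from a X obtain t1 s1 where 1: "exec (compile a k) s t1 s1" "t1 \<le> X ^ ca"
        "\<And>x. x \<noteq> ''t'' \<Longrightarrow> s1 x = s x" "\<And>i. i < k \<Longrightarrow> s1 ''t'' i = s ''t'' i"
        "s1 ''t'' k = ?N" "?N \<le> X ^ ca"
      unfolding poly_computed_def computes_def by blast
    have Y: "2 \<le> ?Y" "X \<le> ?Y" "X ^ ca \<le> ?Y"
      using X(1) self_le_power[of X "ca + 1"] power_increasing[of ca "ca + 1" X] by linarith+
    have Yd: "?Y ^ cb = X ^ d" by (simp only: d_def power_mult)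
    have bound: "bounded_state ?Y s'" if "i < ?N \<or> i = 0" "s' ''v'' = (s ''v'')(v := i)"
      "\<And>x. x \<noteq> ''t'' \<Longrightarrow> x \<noteq> ''v'' \<Longrightarrow> s' x = s x" for s' i
      unfolding bounded_state_def
    proof (intro allI impI)
      fix x j assume x: "x \<noteq> ''t''"
      have i: "i \<le> ?Y" using that(1) 1(6) Y(3) by linarith
      have "s x j \<le> ?Y" using bounded_stateD[OF X(2) x] Y(2) order_trans by blast
      then show "s' x j \<le> ?Y" using that i x by (cases "x = ''v''") auto
    qed
    have eq: "xval b s' (s' ''v'') = ?b i" if "s' ''v'' = (s ''v'')(v := i)"
      "\<And>x. x \<noteq> ''t'' \<Longrightarrow> x \<noteq> ''v'' \<Longrightarrow> s' x = s x" for s' i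
      using xval_cong[OF wf(2), of s' s] that by simp
    have bval_le: "?b i \<le> X ^ d" if "i < ?N" for i
    proof -
      let ?s = "s(''v'' := (s ''v'')(v := i))"
      have "bounded_state ?Y ?s" by (rule bound[of i]) (use that in auto)
      then have "xval b ?s (?s ''v'') \<le> ?Y ^ cb" using b Y(1) unfolding poly_computed_def by blast
      moreover have eqv: "xval b ?s (?s ''v'') = ?b i" by (rule eq) auto
      ultimately show ?thesis by (simp only: eqv Yd)
    qed
    define I where "I = (\<lambda>i s'. (\<forall>x. x \<noteq> ''t'' \<longrightarrow> x \<noteq> ''v'' \<longrightarrow> s' x = s x) \<and>
      s' ''v'' = (s ''v'')(v := i) \<and> (\<forall>j<k. s' ''t'' j = s ''t'' j) \<and> s' ''t'' k = ?N \<and>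
      s' ''t'' (k + 1) = (\<Sum>i<i. ?b i) \<and> s' ''t'' (k + 2) = s ''v'' v)"
    let ?body = "Seq (compile b (k + 3)) (Seq (set_tmp (k + 1) (Add (tmp (k + 1)) (tmp (k + 3))))
         (set_var v (Add (var v) (Lit 1))))"
    let ?cond = "Less (var v) (tmp k)"
    let ?T = "X ^ d + 20"
    have step: "bval ?cond s' \<and> (\<exists>t s''. exec ?body s' t s'' \<and> t \<le> ?T \<and> I (Suc i) s'')"
      if "i < ?N" "I i s'" for i s'
    proof -
      have s': "s' ''v'' = (s ''v'')(v := i)" "\<And>x. x \<noteq> ''t'' \<Longrightarrow> x \<noteq> ''v'' \<Longrightarrow> s' x = s x"
        using that(2) by (auto simp: I_def)
      have "bounded_state ?Y s'" by (rule bound[of i]) (use that(1) s' in auto)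
      with b Y(1) have "computes (?Y ^ cb) (compile b (k + 3)) (k + 3) s' (xval b s' (s' ''v''))"
        unfolding poly_computed_def by blast
      moreover have "xval b s' (s' ''v'') = ?b i" by (rule eq) (use s' in auto)
      ultimately have "computes (X ^ d) (compile b (k + 3)) (k + 3) s' (?b i)" by (simp only: Yd)
      then obtain t s2 where 2: "exec (compile b (k + 3)) s' t s2" "t \<le> X ^ d"
        "\<And>x. x \<noteq> ''t'' \<Longrightarrow> s2 x = s' x" "\<And>i. i < k + 3 \<Longrightarrow> s2 ''t'' i = s' ''t'' i"
        "s2 ''t'' (k + 3) = ?b i"
        unfolding computes_def by blast
      let ?s3 = "s2(''t'' := (s2 ''t'')(k + 1 := s2 ''t'' (k + 1) + s2 ''t'' (k + 3)))"
      let ?s4 = "?s3(''v'' := (s2 ''v'')(v := Suc (s2 ''v'' v)))"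
      have "exec (set_tmp (k + 1) (Add (tmp (k + 1)) (tmp (k + 3)))) s2 7 ?s3"
        using exec.Assign[of "''t''" "Lit (k + 1)" "Add (tmp (k + 1)) (tmp (k + 3))" s2]
        by (simp add: eval_nat_numeral)
      moreover have "exec (set_var v (Add (var v) (Lit 1))) ?s3 6 ?s4"
        using exec.Assign[of "''v''" "Lit v" "Add (var v) (Lit 1)" ?s3]
        by (simp add: eval_nat_numeral)
      ultimately have Seq: "exec ?body s' (1 + t + (1 + 7 + 6)) ?s4"
        by (intro exec.Seq[OF 2(1)] exec.Seq)
      have "bval ?cond s'" using that by (auto simp: I_def)
      moreover have "\<exists>t s''. exec ?body s' t s'' \<and> t \<le> ?T \<and> I (Suc i) s''"
      proof (intro exI conjI)
        show "exec ?body s' (1 + t + (1 + 7 + 6)) ?s4" by (rule Seq)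
        show "1 + t + (1 + 7 + 6) \<le> ?T" using 2(2) by simp
        show "I (Suc i) ?s4" using 2(3-5) that(2) by (simp add: I_def)
      qed
      ultimately show ?thesis by blast
    qed
    let ?s4 = "s1(''t'' := (s1 ''t'')(k + 1 := 0, k + 2 := s ''v'' v), ''v'' := (s ''v'')(v := 0))"
    have I0: "I 0 ?s4" using 1 by (auto simp: I_def)
    have end_loop: "\<not> bval ?cond s'" if "I ?N s'" for s' using that by (simp add: I_def)
    obtain t5 s5 where 5: "exec (While ?cond ?body) ?s4 t5 s5"
      "t5 \<le> (?N + 1) * (?T + 1 + bcost ?cond)" "I ?N s5"
      using while_count[where I = I, OF step end_loop I0] by blast
    have "\<exists>t s'. exec (compile (XSum v a b) k) s t s' \<and> t \<le> t1 + t5 + 64 \<and>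
       s' = s5(''v'' := (s5 ''v'')(v := s5 ''t'' (k + 2)), ''t'' := (s5 ''t'')(k := s5 ''t'' (k + 1)))"
    proof -
      have "exec (Seq (set_tmp (k + 1) (Lit 0)) (Seq (set_tmp (k + 2) (var v)) (Seq (set_var v (Lit 0))
         (Seq (While ?cond ?body) (Seq (set_var v (tmp (k + 2))) (set_tmp k (tmp (k + 1)))))))) s1
         (1 + 3 + (1 + 4 + (1 + 3 + (1 + t5 + (1 + 4 + 4)))))
         (s5(''v'' := (s5 ''v'')(v := s5 ''t'' (k + 2)), ''t'' := (s5 ''t'')(k := s5 ''t'' (k + 1))))"
        (is "exec _ _ ?t ?s")
      proof -
        have A: "exec (Assign x (Lit j) e) s0 (2 + acost e) (s0(x := (s0 x)(j := aval e s0)))" for x j e s0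
          using exec.Assign[of x "Lit j" e s0] by simp
        have 6: "exec (Seq (set_var v (tmp (k + 2))) (set_tmp k (tmp (k + 1)))) s5 (1 + 4 + 4) ?s"
          using exec.Seq[OF A[of "''v''" v "tmp (k + 2)" s5] A[of "''t''" k "tmp (k + 1)"]] by simp
        note 7 = exec.Seq[OF 5(1) 6]
        have 8: "exec (set_tmp (k + 1) (Lit 0)) s1 3 (s1(''t'' := (s1 ''t'')(k + 1 := 0)))"
          using A[of "''t''" "k + 1" "Lit 0" s1] by simp
        have 9: "exec (set_tmp (k + 2) (var v)) (s1(''t'' := (s1 ''t'')(k + 1 := 0))) 4
           (s1(''t'' := (s1 ''t'')(k + 1 := 0, k + 2 := s ''v'' v)))"
          using A[of "''t''" "k + 2" "var v" "s1(''t'' := (s1 ''t'')(k + 1 := 0))"] 1(3) by simp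
        have 10: "exec (set_var v (Lit 0)) (s1(''t'' := (s1 ''t'')(k + 1 := 0, k + 2 := s ''v'' v))) 3 ?s4"
          using A[of "''v''" v "Lit 0" "s1(''t'' := (s1 ''t'')(k + 1 := 0, k + 2 := s ''v'' v))"] 1(3)
          by simp
        show ?thesis by (rule exec.Seq[OF 8 exec.Seq[OF 9 exec.Seq[OF 10 7]]])
      qed
      from exec.Seq[OF 1(1) this] have "exec (compile (XSum v a b) k) s (1 + t1 + ?t) ?s" by simp
      moreover have "1 + t1 + ?t \<le> t1 + t5 + 64" by simp
      ultimately show ?thesis by blast
    qed
    then obtain t s' where 6: "exec (compile (XSum v a b) k) s t s'" "t \<le> t1 + t5 + 64"
      "s' = s5(''v'' := (s5 ''v'')(v := s5 ''t'' (k + 2)), ''t'' := (s5 ''t'')(k := s5 ''t'' (k + 1)))"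
      by blast
    have s': "(\<forall>x. x \<noteq> ''t'' \<longrightarrow> s' x = s x) \<and> (\<forall>i<k. s' ''t'' i = s ''t'' i) \<and>
        s' ''t'' k = xval (XSum v a b) s (s ''v'')"
      using 5(3) by (auto simp: I_def 6(3))
    let ?e = "ca + d + 5"
    have le: "X ^ ca \<le> X ^ ?e" "X ^ d \<le> X ^ ?e" "32 \<le> X ^ ?e"
      using X(1) small_le_power[of X 32 5] order_trans[OF _ power_increasing[of 5 ?e X]]
      by (auto intro: power_increasing)
    have "xval (XSum v a b) s (s ''v'') \<le> (\<Sum>i<?N. X ^ d)"
      unfolding xval.simps by (rule sum_mono) (use bval_le in simp)
    also have "\<dots> \<le> X ^ ca * X ^ d" using 1(6) by simp
    also have "\<dots> \<le> X ^ c" using X(1) by (simp add: c_def flip: power_add)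
    finally have v: "xval (XSum v a b) s (s ''v'') \<le> X ^ c" .
    have "t5 \<le> (?N + 1) * (X ^ d + 32)"
      by (rule order_trans[OF 5(2)], rule mult_le_mono2) simp
    also have "\<dots> \<le> (X ^ ?e + X ^ ?e) * (X ^ ?e + X ^ ?e)"
      using le 1(6) by (intro mult_mono add_mono) linarith+
    also have "\<dots> = 4 * (X ^ ?e * X ^ ?e)" by (simp add: algebra_simps)
    finally have t5: "t5 \<le> 4 * (X ^ ?e * X ^ ?e)" .
    define p where "p = X ^ ?e"
    have "p \<le> p * p" by (rule le_square)
    moreover have "t5 \<le> 4 * (p * p)" "32 \<le> p" "t1 \<le> p"
      using t5 le(3) order_trans[OF 1(2) le(1)] unfolding p_def by blast+
    ultimately have tp: "t \<le> 16 * (p * p)" using 6(2) by linarith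
    have "(16::nat) \<le> X ^ 4" using small_le_power[OF X(1), of 16 4] by simp
    then have "16 * (p * p) \<le> X ^ 4 * (p * p)" by (rule mult_right_mono) simp
    moreover have "X ^ 4 * (p * p) = X ^ c"
      unfolding p_def c_def mult_2 power_add by (simp only: mult_ac)
    ultimately have "t \<le> X ^ c" using tp by linarith
    with 6(1) s' have "computes (X ^ c) (compile (XSum v a b) k) k s (xval (XSum v a b) s (s ''v''))"
      unfolding computes_def by (intro exI[of _ t] exI[of _ s'] conjI) simp_all
    with v show ?thesis by simp
  qed
  then have "poly_computed (XSum v a b) c" unfolding poly_computed_def by blast
  then show ?thesis ..
qed

lemma compile_correct: "wfx e \<Longrightarrow> \<exists>c. poly_computed e c"
proof (induction e)
  case (XLit m)
  \<comment> \<open>A literal may exceed \<open>X\<close>, so the exponent has to grow with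
    it.\<close>
  have "poly_computed (XLit m) (m + 3)"
    unfolding poly_computed_def computes_def
  proof (intro allI impI conjI)
    fix X s k assume "2 \<le> (X::nat)"
    have "m \<le> 2 ^ (m + 3)" using less_exp[of "m + 3"] by linarith
    with \<open>2 \<le> X\<close> show "xval (XLit m) s (s ''v'') \<le> X ^ (m + 3)"
      using small_le_power by simp
    have "3 \<le> X ^ (m + 3)" using small_le_power[OF \<open>2 \<le> X\<close>, of 3 "m + 3"] less_exp[of "m+3"] by linarith
    moreover have "exec (set_tmp k (Lit m)) s 3 (s(''t'' := (s ''t'')(k := m)))"
      using exec.Assign[of "''t''" "Lit k" "Lit m" s] by (simp add: numeral_3_eq_3)
    ultimately show "\<exists>t s'. exec (compile (XLit m) k) s t s' \<and> t \<le> X ^ (m + 3) \<and>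
        (\<forall>x. x \<noteq> ''t'' \<longrightarrow> s' x = s x) \<and> (\<forall>i<k. s' ''t'' i = s ''t'' i) \<and>
        s' ''t'' k = xval (XLit m) s (s ''v'')"
      by (intro exI[of _ 3] exI[of _ "s(''t'' := (s ''t'')(k := m))"] conjI) simp_all
  qed
  then show ?case ..
next
  case (XVar v)
  have "poly_computed (XVar v) 3"
    unfolding poly_computed_def computes_def
  proof (intro allI impI conjI)
    fix X s k assume X: "2 \<le> (X::nat)" "bounded_state X s"
    then have "s ''v'' v \<le> X" by (intro bounded_stateD) auto
    also have "X \<le> X ^ 3" using X(1) by (intro self_le_power) auto
    finally show "xval (XVar v) s (s ''v'') \<le> X ^ 3" by simp
    have "4 \<le> X ^ 3" using small_le_power[OF X(1), of 4 3] by simp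
    moreover have "exec (set_tmp k (var v)) s 4 (s(''t'' := (s ''t'')(k := s ''v'' v)))"
      using exec.Assign[of "''t''" "Lit k" "var v" s] by (simp add: eval_nat_numeral)
    ultimately show "\<exists>t s'. exec (compile (XVar v) k) s t s' \<and> t \<le> X ^ 3 \<and>
        (\<forall>x. x \<noteq> ''t'' \<longrightarrow> s' x = s x) \<and> (\<forall>i<k. s' ''t'' i = s ''t'' i) \<and>
        s' ''t'' k = xval (XVar v) s (s ''v'')"
      by (intro exI[of _ 4] exI[of _ "s(''t'' := (s ''t'')(k := s ''v'' v))"] conjI) simp_all
  qed
  then show ?case ..
next
  case (XCell x e)
  then obtain c where c: "poly_computed e c" and x: "x \<noteq> ''t''" "x \<noteq> ''v''" by auto
  \<comment> \<open>\<open>binary_time\<close> is applied with a dummy second operand of time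
    0.\<close>
  have "poly_computed (XCell x e) (c + c + 7)"
    unfolding poly_computed_def
  proof (intro allI impI conjI)
    fix X s k assume X: "2 \<le> (X::nat)" "bounded_state X s"
    have "xval (XCell x e) s (s ''v'') \<le> X" using X x by (simp add: bounded_stateD)
    also have "X \<le> X ^ (c + c + 7)" using X(1) by (intro self_le_power) auto
    finally show "xval (XCell x e) s (s ''v'') \<le> X ^ (c + c + 7)" .
    from c X obtain t1 s1 where 1: "exec (compile e k) s t1 s1" "t1 \<le> X ^ c"
        "\<And>x. x \<noteq> ''t'' \<Longrightarrow> s1 x = s x" "\<And>i. i < k \<Longrightarrow> s1 ''t'' i = s ''t'' i"
        "s1 ''t'' k = xval e s (s ''v'')"
      unfolding poly_computed_def computes_def by blast
    have "t1 + 0 + 6 \<le> X ^ (c + c + 7)" by (rule binary_time[OF X(1) 1(2)]) auto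
    then show "computes (X ^ (c + c + 7)) (compile (XCell x e) k) k s (xval (XCell x e) s (s ''v''))"
      unfolding compile.simps
      by (intro computesI[OF exec.Seq[OF 1(1) exec.Assign]]) (use 1 x in simp_all)
  qed
  then show ?case ..
next
  case (XAdd a b)
  then obtain ca cb where c: "poly_computed a ca" "poly_computed b cb" and wf: "wfx a" "wfx b" by auto
  have "poly_computed (XAdd a b) (ca + cb + 7)"
    unfolding poly_computed_def
  proof (intro allI impI)
    fix X s k assume X: "2 \<le> (X::nat)" "bounded_state X s"
    obtain t t' s' s'' where 1: "exec (compile a k) s t s'" "exec (compile b (Suc k)) s' t' s''"
      "t \<le> X ^ ca" "t' \<le> X ^ cb" "\<forall>x. x \<noteq> ''t'' \<longrightarrow> s'' x = s x"
      "\<forall>i<k. s'' ''t'' i = s ''t'' i" "s'' ''t'' k = xval a s (s ''v'')"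
      "s'' ''t'' (Suc k) = xval b s (s ''v'')"
      "xval a s (s ''v'') \<le> X ^ ca" "xval b s (s ''v'') \<le> X ^ cb"
      by (rule exec_binary[OF c wf X, of k], rule that, assumption+)
    show "xval (XAdd a b) s (s ''v'') \<le> X ^ (ca + cb + 7) \<and>
       computes (X ^ (ca + cb + 7)) (compile (XAdd a b) k) k s (xval (XAdd a b) s (s ''v''))"
      using binary_time[OF X(1) 1(9,10), of 0] binary_time[OF X(1) 1(3,4), of 10]
      unfolding compile.simps
      by (intro conjI computesI[OF exec.Seq[OF 1(1) exec.Seq[OF 1(2) exec.Assign]]])
        (use 1 in simp_all)
  qed
  then show ?case ..
next
  case (XSub a b)
  then obtain ca cb where c: "poly_computed a ca" "poly_computed b cb" and wf: "wfx a" "wfx b" by auto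
  have "poly_computed (XSub a b) (ca + cb + 7)"
    unfolding poly_computed_def
  proof (intro allI impI)
    fix X s k assume X: "2 \<le> (X::nat)" "bounded_state X s"
    obtain t t' s' s'' where 1: "exec (compile a k) s t s'" "exec (compile b (Suc k)) s' t' s''"
      "t \<le> X ^ ca" "t' \<le> X ^ cb" "\<forall>x. x \<noteq> ''t'' \<longrightarrow> s'' x = s x"
      "\<forall>i<k. s'' ''t'' i = s ''t'' i" "s'' ''t'' k = xval a s (s ''v'')"
      "s'' ''t'' (Suc k) = xval b s (s ''v'')"
      "xval a s (s ''v'') \<le> X ^ ca" "xval b s (s ''v'') \<le> X ^ cb"
      by (rule exec_binary[OF c wf X, of k], rule that, assumption+)
    show "xval (XSub a b) s (s ''v'') \<le> X ^ (ca + cb + 7) \<and>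
       computes (X ^ (ca + cb + 7)) (compile (XSub a b) k) k s (xval (XSub a b) s (s ''v''))"
      using binary_time[OF X(1) 1(9,10), of 0] binary_time[OF X(1) 1(3,4), of 10]
      unfolding compile.simps
      by (intro conjI computesI[OF exec.Seq[OF 1(1) exec.Seq[OF 1(2) exec.Assign]]])
        (use 1 in simp_all)
  qed
  then show ?case ..
next
  case (XLess a b)
  then obtain ca cb where c: "poly_computed a ca" "poly_computed b cb" and wf: "wfx a" "wfx b" by auto
  have "poly_computed (XLess a b) (ca + cb + 7)"
    unfolding poly_computed_def
  proof (intro allI impI)
    fix X s k assume X: "2 \<le> (X::nat)" "bounded_state X s"
    obtain t t' s' s'' where 1: "exec (compile a k) s t s'" "exec (compile b (Suc k)) s' t' s''"
      "t \<le> X ^ ca" "t' \<le> X ^ cb" "\<forall>x. x \<noteq> ''t'' \<longrightarrow> s'' x = s x"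
      "\<forall>i<k. s'' ''t'' i = s ''t'' i" "s'' ''t'' k = xval a s (s ''v'')"
      "s'' ''t'' (Suc k) = xval b s (s ''v'')"
      "xval a s (s ''v'') \<le> X ^ ca" "xval b s (s ''v'') \<le> X ^ cb"
      by (rule exec_binary[OF c wf X, of k], rule that, assumption+)
    let ?lt = "xval a s (s ''v'') < xval b s (s ''v'')"
    have "exec (Cond (Less (tmp k) (tmp (Suc k))) (set_tmp k (Lit 1)) (set_tmp k (Lit 0))) s'' 9
        (s''(''t'' := (s'' ''t'')(k := of_bool ?lt)))"
      using exec.CondTrue[OF _ exec.Assign[of "''t''" "Lit k" "Lit 1" s''],
          of "Less (tmp k) (tmp (Suc k))" "set_tmp k (Lit 0)"]
        exec.CondFalse[OF _ exec.Assign[of "''t''" "Lit k" "Lit 0" s''],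
          of "Less (tmp k) (tmp (Suc k))" "set_tmp k (Lit 1)"] 1
      by (cases ?lt) (auto simp: eval_nat_numeral)
    note computesI[OF exec.Seq[OF 1(1) exec.Seq[OF 1(2) this]]]
    then have "computes (X ^ (ca + cb + 7)) (compile (XLess a b) k) k s (xval (XLess a b) s (s ''v''))"
      unfolding compile.simps
      using binary_time[OF X(1) 1(3,4), of 11] 1 by simp
    moreover have "xval (XLess a b) s (s ''v'') \<le> X ^ (ca + cb + 7)"
      using binary_time[OF X(1), of 0 ca 0 cb 1] by simp
    ultimately show "xval (XLess a b) s (s ''v'') \<le> X ^ (ca + cb + 7) \<and>
       computes (X ^ (ca + cb + 7)) (compile (XLess a b) k) k s (xval (XLess a b) s (s ''v''))" by blast
  qed
  then show ?case ..
next
  case (XSum v a b)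
  then obtain ca cb where "poly_computed a ca" "poly_computed b cb" "wfx a" "wfx b" by auto
  then show ?case by (rule poly_computed_XSum)
qed

section \<open>Loops over expressions\<close>

text \<open>Assertions see the memory without the private arrays, so they survive scratch
  work.\<close>

definition mem :: "state \<Rightarrow> state" where
  "mem s = s(''t'' := (\<lambda>_. 0), ''v'' := (\<lambda>_. 0))"

abbreviation counter :: "nat \<Rightarrow> nat \<Rightarrow> nat" where
  "counter k \<equiv> (\<lambda>_. 0)(0 := k)"

text \<open>The target cell is the loop counter. Outside loops the counter is 0, so the same command
  assigns scalars.\<close>

definition setc :: "string \<Rightarrow> xexp \<Rightarrow> com" where
  "setc x e = Seq (compile e 0) (Assign x (var 0) (tmp 0))"

definition forc :: "aexp \<Rightarrow> com \<Rightarrow> com" where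
  "forc N c = Seq (While (Less (var 0) N) (Seq c (set_var 0 (Add (var 0) (Lit 1))))) (set_var 0 (Lit 0))"

text \<open>
  A Hoare triple with a time bound polynomial in \<open>X\<close>, where \<open>X\<close> also bounds all numbers in memory.
  The ghost parameter \<open>g\<close> stands for the input and \<open>k\<close> for the value of the loop counter.
\<close>

definition triple :: "('g \<Rightarrow> nat \<Rightarrow> nat \<Rightarrow> state \<Rightarrow> bool) \<Rightarrow> com \<Rightarrow> ('g \<Rightarrow> nat \<Rightarrow> nat \<Rightarrow> state \<Rightarrow> bool) \<Rightarrow> bool"
  where "triple P c Q \<longleftrightarrow> (\<exists>d. \<forall>g k X s. 2 \<le> X \<longrightarrow> P g k X (mem s) \<longrightarrow> s ''v'' = counter k \<longrightarrow>
    bounded_state X s \<longrightarrow>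
    (\<exists>t s'. exec c s t s' \<and> t \<le> X ^ d \<and> Q g k X (mem s') \<and> s' ''v'' = counter k \<and> bounded_state X s'))"

lemma triple_seq:
  assumes "triple P c R" "triple R d Q"
  shows "triple P (Seq c d) Q"
proof -
  from assms obtain dc dd where
    1: "\<And>g k X s. 2 \<le> X \<Longrightarrow> P g k X (mem s) \<Longrightarrow> s ''v'' = counter k \<Longrightarrow> bounded_state X s \<Longrightarrow>
      \<exists>t s'. exec c s t s' \<and> t \<le> X ^ dc \<and> R g k X (mem s') \<and> s' ''v'' = counter k \<and> bounded_state X s'" and
    2: "\<And>g k X s. 2 \<le> X \<Longrightarrow> R g k X (mem s) \<Longrightarrow> s ''v'' = counter k \<Longrightarrow> bounded_state X s \<Longrightarrow>
      \<exists>t s'. exec d s t s' \<and> t \<le> X ^ dd \<and> Q g k X (mem s') \<and> s' ''v'' = counter k \<and> bounded_state X s'"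
    unfolding triple_def by blast
  show ?thesis unfolding triple_def
  proof (rule exI[of _ "dc + dd + 7"], intro allI impI)
    fix g k X s
    assume X: "2 \<le> (X::nat)" and "P g k X (mem s)" "s ''v'' = counter k" "bounded_state X s"
    from 1[OF this] obtain t s' where 3: "exec c s t s'" "t \<le> X ^ dc" "R g k X (mem s')"
      "s' ''v'' = counter k" "bounded_state X s'" by blast
    from 2[OF X 3(3-5)] obtain t' s'' where 4: "exec d s' t' s''" "t' \<le> X ^ dd" "Q g k X (mem s'')"
      "s'' ''v'' = counter k" "bounded_state X s''" by blast
    have "1 + t + t' \<le> X ^ (dc + dd + 7)" using binary_time[OF X 3(2) 4(2), of 1] by simp
    with exec.Seq[OF 3(1) 4(1)] 4(3-5) show "\<exists>t s'. exec (Seq c d) s t s' \<and> t \<le> X ^ (dc + dd + 7) \<and> Q g k X (mem s') \<and>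
        s' ''v'' = counter k \<and> bounded_state X s'"
      by blast
  qed
qed

text \<open>Compilation bounds the value only by a power of \<open>X\<close>. The assumption
  \<open>post\<close> demands \<open>X\<close> itself, so that the memory bound does not grow from
  one round to the next.\<close>

lemma triple_set:
  assumes wf: "wfx e" and x: "x \<noteq> ''t''" "x \<noteq> ''v''"
    and post: "\<And>g k X m. P g k X m \<Longrightarrow> (\<And>y i. m y i \<le> X) \<Longrightarrow>
      xval e m (counter k) \<le> X \<and> Q g k X (m(x := (m x)(k := xval e m (counter k))))"
  shows "triple P (setc x e) Q"
proof -
  obtain d where d: "poly_computed e d" using compile_correct[OF wf] ..
  show ?thesis unfolding triple_def
  proof (rule exI[of _ "d + d + 7"], intro allI impI)
    fix g k X s
    assume X: "2 \<le> (X::nat)" and P: "P g k X (mem s)" and v: "s ''v'' = counter k"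
      and b: "bounded_state X s"
    have val: "xval e s (s ''v'') = xval e (mem s) (counter k)"
      unfolding v by (rule xval_cong[OF wf]) (simp add: mem_def)
    have "mem s y i \<le> X" for y i using b by (simp add: mem_def bounded_state_def)
    note post = post[OF P this]
    from d X b obtain t s1 where 1: "exec (compile e 0) s t s1" "t \<le> X ^ d"
        "\<And>x. x \<noteq> ''t'' \<Longrightarrow> s1 x = s x" "s1 ''t'' 0 = xval e (mem s) (counter k)"
      unfolding poly_computed_def computes_def val[symmetric] by blast
    let ?s = "s1(x := (s1 x)(k := xval e (mem s) (counter k)))"
    have "exec (Assign x (var 0) (tmp 0)) s1 5 ?s"
      using exec.Assign[of x "var 0" "tmp 0" s1] 1(3)[of "''v''"] 1(4) v by (simp add: eval_nat_numeral)
    from exec.Seq[OF 1(1) this] have "exec (setc x e) s (1 + t + 5) ?s" unfolding setc_def .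
    moreover have "1 + t + 5 \<le> X ^ (d + d + 7)" using binary_time[OF X 1(2), of 0 d 6] by simp
    moreover have "mem ?s = (mem s)(x := (mem s x)(k := xval e (mem s) (counter k)))"
      using 1(3) x by (auto simp: mem_def fun_eq_iff)
    then have "Q g k X (mem ?s)" using post by simp
    moreover have "?s ''v'' = counter k" using 1(3) x v by simp
    moreover have "bounded_state X ?s" using 1(3) b post by (simp add: bounded_state_def)
    ultimately show "\<exists>t s'. exec (setc x e) s t s' \<and> t \<le> X ^ (d + d + 7) \<and> Q g k X (mem s') \<and>
        s' ''v'' = counter k \<and> bounded_state X s'" by blast
  qed
qed

lemma triple_for:
  assumes body: "triple (\<lambda>g k X m. k < K g \<and> I g k X m) c (\<lambda>g k. I g (Suc k))"
    and bound: "\<And>g k X s. I g k X (mem s) \<Longrightarrow> aval N s = K g \<and> K g \<le> X"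
  shows "triple (\<lambda>g k X m. k = 0 \<and> I g 0 X m) (forc N c) (\<lambda>g k X m. k = 0 \<and> I g (K g) X m)"
proof -
  from body obtain d where d: "\<And>g k X s. 2 \<le> X \<Longrightarrow> k < K g \<and> I g k X (mem s) \<Longrightarrow> s ''v'' = counter k \<Longrightarrow>
      bounded_state X s \<Longrightarrow> \<exists>t s'. exec c s t s' \<and> t \<le> X ^ d \<and> I g (Suc k) X (mem s') \<and>
        s' ''v'' = counter k \<and> bounded_state X s'"
    unfolding triple_def by blast
  let ?b = "Less (var 0) N"
  let ?inc = "set_var 0 (Add (var 0) (Lit 1))"
  \<comment> \<open>Larger than the overhead of a round; \<open>D \<le> 2 ^ D\<close> moves it into
    the exponent. The 2 added below pays for \<open>K g + 1 \<le> X ^ 2\<close> rounds.\<close>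
  define D where "D = 6 + acost N + 20"
  show ?thesis unfolding triple_def
  proof (rule exI[of _ "2 + (d + D)"], intro allI impI)
    fix g k X s
    assume X: "2 \<le> (X::nat)" and I0: "k = 0 \<and> I g 0 X (mem s)" and v: "s ''v'' = counter k"
      and b: "bounded_state X s"
    let ?J = "\<lambda>k s. k \<le> K g \<and> I g k X (mem s) \<and> s ''v'' = counter k \<and> bounded_state X s"
    have step: "bval ?b s \<and> (\<exists>t s'. exec (Seq c ?inc) s t s' \<and> t \<le> X ^ d + 10 \<and> ?J (Suc k) s')"
      if "k < K g" "?J k s" for k s
    proof -
      from d[OF X, of k g s] that obtain t s' where 1: "exec c s t s'" "t \<le> X ^ d"
        "I g (Suc k) X (mem s')" "s' ''v'' = counter k" "bounded_state X s'" by blast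
      let ?s = "s'(''v'' := counter (Suc k))"
      have "exec ?inc s' 6 ?s"
        using exec.Assign[of "''v''" "Lit 0" "Add (var 0) (Lit 1)" s'] 1(4)
        by (simp add: eval_nat_numeral)
      from exec.Seq[OF 1(1) this] have "exec (Seq c ?inc) s (1 + t + 6) ?s" .
      moreover have "1 + t + 6 \<le> X ^ d + 10" using 1(2) by simp
      moreover have "mem ?s = mem s'" by (auto simp: mem_def)
      \<comment> \<open>The counter is itself a number in memory, hence the requirement
        \<open>K g \<le> X\<close>.\<close>
      moreover have "Suc k \<le> X" using that bound[of g k X s] by auto
      then have "bounded_state X ?s" using 1(5) by (simp add: bounded_state_def)
      moreover have "bval ?b s" using that bound[of g k X s] by simp
      ultimately show ?thesis using 1(3) that(1)
        by (intro conjI exI[of _ "1 + t + 6"] exI[of _ ?s]) simp_all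
    qed
    have stop: "\<not> bval ?b s" if "?J (K g) s" for s using that bound[of g "K g" X s] by simp
    have J0: "?J 0 s" using I0 v b by simp
    from while_count[where I = ?J, OF step stop J0]
    obtain t s' where 1: "exec (While ?b (Seq c ?inc)) s t s'"
      "t \<le> (K g + 1) * (X ^ d + 10 + 1 + bcost ?b)" "?J (K g) s'" by blast
    let ?s = "s'(''v'' := counter 0)"
    have "exec (set_var 0 (Lit 0)) s' 3 ?s"
      using exec.Assign[of "''v''" "Lit 0" "Lit 0" s'] 1(3) by (simp add: eval_nat_numeral)
    from exec.Seq[OF 1(1) this] have "exec (forc N c) s (1 + t + 3) ?s" unfolding forc_def .
    moreover have "1 + t + 3 \<le> X ^ (2 + (d + D))"
    proof -
      have "K g + 1 \<le> X + X" using bound[of g 0 X s] I0 X by simp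
      also have "\<dots> \<le> X ^ 2" using mult_le_mono1[OF X, of X] by (simp only: power2_eq_square mult_2)
      finally have "K g + 1 \<le> X ^ 2" .
      moreover have "X ^ d + 10 + 1 + bcost ?b + 4 \<le> X ^ d * 2 ^ D"
      proof -
        have a: "D \<le> 2 ^ D" by (meson less_exp less_imp_le)
        have one: "1 \<le> X ^ d" using X by simp
        have "X ^ d + 10 + 1 + bcost ?b + 4 \<le> X ^ d * 1 + X ^ d * (D - 1)"
        proof -
          have "10 + 1 + bcost ?b + 4 \<le> 1 * (D - 1)" by (simp add: D_def)
          also have "\<dots> \<le> X ^ d * (D - 1)" by (rule mult_le_mono1[OF one])
          finally show ?thesis by simp
        qed
        also have "\<dots> = X ^ d * D" by (simp add: D_def algebra_simps)
        also have "\<dots> \<le> X ^ d * 2 ^ D" using a by simp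
        finally show ?thesis .
      qed
      then have "X ^ d + 10 + 1 + bcost ?b + 4 \<le> X ^ (d + D)"
        unfolding power_add
        using mult_le_mono2[OF power_mono[OF X zero_le, of D], of "X ^ d"] by (rule order_trans)
      ultimately have "(K g + 1) * (X ^ d + 10 + 1 + bcost ?b + 4) \<le> X ^ 2 * X ^ (d + D)"
        by (rule mult_le_mono)
      moreover have "1 + t + 3 \<le> (K g + 1) * (X ^ d + 10 + 1 + bcost ?b + 4)"
        using 1(2) by (simp add: algebra_simps)
      ultimately show ?thesis unfolding power_add by simp
    qed
    moreover have "mem ?s = mem s'" by (auto simp: mem_def)
    moreover have "bounded_state X ?s" using 1(3) by (simp add: bounded_state_def)
    ultimately show "\<exists>t s'. exec (forc N c) s t s' \<and> t \<le> X ^ (2 + (d + D)) \<and>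
        (k = 0 \<and> I g (K g) X (mem s')) \<and> s' ''v'' = counter k \<and> bounded_state X s'"
      using 1(3) I0 by (intro exI[of _ "1 + t + 3"] exI[of _ ?s]) simp
  qed
qed

lemma triple_conseq:
  assumes "triple P c Q" "\<And>g k X m. P' g k X m \<Longrightarrow> P g k X m" "\<And>g k X m. Q g k X m \<Longrightarrow> Q' g k X m"
  shows "triple P' c Q'"
  using assms unfolding triple_def by meson

section \<open>Logical connectives\<close>

primrec fv :: "xexp \<Rightarrow> nat set" where
  "fv (XLit c) = {}"
| "fv (XVar v) = {v}"
| "fv (XCell x e) = fv e"
| "fv (XAdd a b) = fv a \<union> fv b"
| "fv (XSub a b) = fv a \<union> fv b"
| "fv (XLess a b) = fv a \<union> fv b"
| "fv (XSum v a b) = fv a \<union> (fv b - {v})"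

lemma xval_cong_fv: "(\<And>v. v \<in> fv e \<Longrightarrow> \<rho> v = \<rho>' v) \<Longrightarrow> xval e s \<rho> = xval e s \<rho>'"
proof (induction e arbitrary: \<rho> \<rho>')
  case (XCell x e)
  have "xval e s \<rho> = xval e s \<rho>'" by (rule XCell.IH) (use XCell.prems in auto)
  then show ?case by simp
next
  case (XAdd a b)
  have "xval a s \<rho> = xval a s \<rho>'" by (rule XAdd.IH(1)) (use XAdd.prems in auto)
  moreover have "xval b s \<rho> = xval b s \<rho>'" by (rule XAdd.IH(2)) (use XAdd.prems in auto)
  ultimately show ?case by simp
next
  case (XSub a b)
  have "xval a s \<rho> = xval a s \<rho>'" by (rule XSub.IH(1)) (use XSub.prems in auto)
  moreover have "xval b s \<rho> = xval b s \<rho>'" by (rule XSub.IH(2)) (use XSub.prems in auto)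
  ultimately show ?case by simp
next
  case (XLess a b)
  have "xval a s \<rho> = xval a s \<rho>'" by (rule XLess.IH(1)) (use XLess.prems in auto)
  moreover have "xval b s \<rho> = xval b s \<rho>'" by (rule XLess.IH(2)) (use XLess.prems in auto)
  ultimately show ?case by simp
next
  case (XSum v a b)
  have "xval a s \<rho> = xval a s \<rho>'" by (rule XSum.IH(1)) (use XSum.prems in auto)
  moreover have "xval b s (\<rho>(v := i)) = xval b s (\<rho>'(v := i))" for i
    by (rule XSum.IH(2)) (use XSum.prems in auto)
  ultimately show ?case by simp
qed auto

lemma xval_fresh [simp]: "v \<notin> fv e \<Longrightarrow> xval e s (\<rho>(v := i)) = xval e s \<rho>"
  by (rule xval_cong_fv) auto

text \<open>Every nonzero number counts as true. Thus addition is disjunction and a sum is a bounded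
  existential quantifier; \<open>xbool\<close> normalises where truth values are counted, stored or
  used as a bound.\<close>

abbreviation xnot :: "xexp \<Rightarrow> xexp" where "xnot e \<equiv> XLess e (XLit 1)"
abbreviation xdisj :: "xexp \<Rightarrow> xexp \<Rightarrow> xexp" where "xdisj \<equiv> XAdd"
abbreviation ximp :: "xexp \<Rightarrow> xexp \<Rightarrow> xexp" where "ximp a b \<equiv> xdisj (xnot a) b"
abbreviation xconj :: "xexp \<Rightarrow> xexp \<Rightarrow> xexp" where "xconj a b \<equiv> xnot (ximp a (xnot b))"
abbreviation xeq :: "xexp \<Rightarrow> xexp \<Rightarrow> xexp" where "xeq a b \<equiv> xnot (xdisj (XLess a b) (XLess b a))"
abbreviation xall :: "nat \<Rightarrow> xexp \<Rightarrow> xexp \<Rightarrow> xexp" where "xall v a b \<equiv> xnot (XSum v a (xnot b))"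
abbreviation xbool :: "xexp \<Rightarrow> xexp" where "xbool e \<equiv> XLess (XLit 0) e"

text \<open>The second argument must not depend on the dummy variable 99.\<close>

abbreviation xmul :: "xexp \<Rightarrow> xexp \<Rightarrow> xexp" where "xmul \<equiv> XSum 99"
abbreviation xif :: "xexp \<Rightarrow> xexp \<Rightarrow> xexp" where "xif c e \<equiv> XSum 99 (xbool c) e"

definition truth :: "xexp \<Rightarrow> state \<Rightarrow> (nat \<Rightarrow> nat) \<Rightarrow> bool" where
  "truth e s \<rho> \<longleftrightarrow> 0 < xval e s \<rho>"

lemma truth_simps:
  "truth (xnot e) s \<rho> \<longleftrightarrow> \<not> truth e s \<rho>"
  "truth (XAdd a b) s \<rho> \<longleftrightarrow> truth a s \<rho> \<or> truth b s \<rho>"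
  "truth (xbool e) s \<rho> \<longleftrightarrow> truth e s \<rho>"
  "truth (XSum v a b) s \<rho> \<longleftrightarrow> (\<exists>i<xval a s \<rho>. truth b s (\<rho>(v := i)))"
proof -
  have "0 < sum f {..<N} \<longleftrightarrow> (\<exists>i<N. 0 < f i)" for f :: "nat \<Rightarrow> nat" and N
  proof -
    have "sum f {..<N} = 0 \<longleftrightarrow> (\<forall>i<N. f i = 0)" by auto
    then show ?thesis by (metis neq0_conv)
  qed
  then show "truth (XSum v a b) s \<rho> \<longleftrightarrow> (\<exists>i<xval a s \<rho>. truth b s (\<rho>(v := i)))"
    by (simp add: truth_def)
qed (auto simp: truth_def)

lemma truth_xconj: "truth (xconj a b) s \<rho> \<longleftrightarrow> truth a s \<rho> \<and> truth b s \<rho>"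
  unfolding truth_simps by simp

lemma truth_xall: "truth (xall v a b) s \<rho> \<longleftrightarrow> (\<forall>i<xval a s \<rho>. truth b s (\<rho>(v := i)))"
  unfolding truth_simps by simp

lemma truth_less: "truth (XLess a b) s \<rho> \<longleftrightarrow> xval a s \<rho> < xval b s \<rho>"
  by (simp add: truth_def)

lemma xval_xbool: "xval (xbool e) s \<rho> = of_bool (truth e s \<rho>)"
  by (simp add: truth_def)

lemma xval_xnot: "xval (xnot e) s \<rho> = of_bool (\<not> truth e s \<rho>)"
  by (simp add: truth_def)

lemma xval_xif: "99 \<notin> fv e \<Longrightarrow> xval (xif c e) s \<rho> = (if truth c s \<rho> then xval e s \<rho> else 0)"
  by (simp add: truth_def)

section \<open>The algorithm\<close>

abbreviation nE :: xexp where "nE \<equiv> XCell ''n'' (XLit 0)"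
abbreviation mE :: xexp where "mE \<equiv> XCell ''m'' (XLit 0)"

definition cnE :: "xexp \<Rightarrow> xexp \<Rightarrow> xexp" where
  "cnE a b = xdisj (xeq a b) (XCell ''adj'' (XAdd (xmul a nE) b))"

text \<open>Division by counting: for positive \<open>n\<close>, exactly \<open>e div n\<close>
  numbers \<open>i\<close> satisfy \<open>(i + 1) * n \<le> e\<close>.\<close>

definition divE :: "xexp \<Rightarrow> xexp" where
  "divE e = XSum 1 e (xnot (XLess e (xmul (XAdd (XVar 1) (XLit 1)) nE)))"

definition quotE :: "nat \<Rightarrow> xexp \<Rightarrow> xexp" where
  "quotE k e = (XCell ''q'' ^^ k) e"

definition digitE :: "nat \<Rightarrow> xexp \<Rightarrow> xexp" where
  "digitE k e = XSub (quotE k e) (xmul (quotE (Suc k) e) nE)"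

definition reachE :: "xexp \<Rightarrow> xexp \<Rightarrow> xexp" where
  "reachE e x = xdisj (cnE (digitE 3 e) x) (cnE (digitE 2 e) x)"

definition coreE :: "xexp \<Rightarrow> xexp \<Rightarrow> xexp" where
  "coreE e v = xconj (xall 2 nE (ximp (cnE v (XVar 2)) (reachE e (XVar 2))))
     (xconj (cnE (digitE 1 e) v) (cnE (digitE 0 e) v))"

definition validE :: "xexp \<Rightarrow> xexp" where
  "validE e = xconj (cnE (digitE 3 e) (digitE 2 e))
     (xall 3 nE (xall 4 nE (ximp (coreE e (XVar 3)) (ximp (coreE e (XVar 4)) (cnE (XVar 3) (XVar 4))))))"

definition weightE :: "xexp \<Rightarrow> xexp" where
  "weightE e = xif (validE e) (XSum 5 nE (xbool (coreE e (XVar 5))))"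

definition conflictE :: "xexp \<Rightarrow> xexp \<Rightarrow> xexp" where
  "conflictE e f = XSum 6 nE (xconj (reachE e (XVar 6)) (reachE f (XVar 6)))"

definition residueE :: "xexp \<Rightarrow> xexp \<Rightarrow> xexp" where
  "residueE t j = XSub (weightE j)
     (XSum 7 t (xif (conflictE (XCell ''stk'' (XVar 7)) j) (XCell ''eps'' (XVar 7))))"

definition goodE :: "xexp \<Rightarrow> xexp \<Rightarrow> xexp" where
  "goodE t i = xconj (residueE t i) (xall 8 mE (xall 9 mE
     (ximp (residueE t (XVar 8)) (ximp (residueE t (XVar 9)) (ximp (conflictE i (XVar 8))
       (ximp (conflictE i (XVar 9)) (conflictE (XVar 8) (XVar 9))))))))"

text \<open>Minimisation by counting: the number of \<open>i\<close> such that no item up to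
  \<open>i\<close> is good is the least good item, or \<open>m\<close>, the code for none, if there
  is no good item.\<close>

definition pickE :: "xexp \<Rightarrow> xexp" where
  "pickE t = XSum 10 mE (xnot (XSum 11 (XAdd (XVar 10) (XLit 1)) (goodE t (XVar 11))))"

definition amountE :: "xexp \<Rightarrow> xexp" where
  "amountE t = xif (XLess (XCell ''stk'' t) mE) (residueE t (XCell ''stk'' t))"

text \<open>Array \<open>''sel''\<close> is filled in reverse order: its cell \<open>u\<close> belongs to the stack cell \<open>m - 1 - u\<close>.\<close>

abbreviation revE :: "xexp \<Rightarrow> xexp" where
  "revE u \<equiv> XSub mE (XAdd u (XLit 1))"

definition selectE :: "xexp \<Rightarrow> xexp" where
  "selectE u = xbool (xconj (XCell ''eps'' (revE u)) (xall 12 u (ximp (XCell ''sel'' (XVar 12))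
     (xnot (conflictE (XCell ''stk'' (revE (XVar 12))) (XCell ''stk'' (revE u)))))))"

definition outputE :: "xexp \<Rightarrow> xexp" where
  "outputE v = xbool (XSum 13 mE
     (xconj (XCell ''sel'' (XVar 13)) (coreE (XCell ''stk'' (revE (XVar 13))) v)))"

definition program :: com where
  "program = Seq (setc ''m'' (xmul nE (xmul nE (xmul nE nE))))
    (Seq (forc (Add (Cell ''m'' (Lit 0)) (Lit 1)) (setc ''q'' (divE (XVar 0))))
    (Seq (forc (Cell ''m'' (Lit 0)) (Seq (setc ''stk'' (pickE (XVar 0))) (setc ''eps'' (amountE (XVar 0)))))
    (Seq (forc (Cell ''m'' (Lit 0)) (setc ''sel'' (selectE (XVar 0))))
      (forc (Cell ''n'' (Lit 0)) (setc ''out'' (outputE (XVar 0)))))))"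

lemma fv_quotE [simp]: "fv (quotE k e) = fv e"
  by (induction k) (simp_all add: quotE_def)

lemma wfx_quotE [simp]: "wfx (quotE k e) = wfx e"
  by (induction k) (simp_all add: quotE_def)

lemma fv_exps [simp]:
  "fv (cnE a b) = fv a \<union> fv b"
  "fv (digitE k e) = fv e"
  "fv (reachE e x) = fv e \<union> fv x"
  by (auto simp: cnE_def digitE_def reachE_def)

lemma fv_coreE [simp]:
  "2 \<notin> fv e \<Longrightarrow> 2 \<notin> fv v \<Longrightarrow> fv (coreE e v) = fv e \<union> fv v"
  by (auto simp: coreE_def)

lemma wfx_exps:
  "wfx a \<Longrightarrow> wfx b \<Longrightarrow> wfx (cnE a b)"
  "wfx a \<Longrightarrow> wfx (digitE k a)"
  "wfx a \<Longrightarrow> wfx b \<Longrightarrow> wfx (reachE a b)"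
  "wfx a \<Longrightarrow> wfx b \<Longrightarrow> wfx (coreE a b)"
  "wfx a \<Longrightarrow> wfx (validE a)"
  "wfx a \<Longrightarrow> wfx (weightE a)"
  "wfx a \<Longrightarrow> wfx b \<Longrightarrow> wfx (conflictE a b)"
  "wfx a \<Longrightarrow> wfx b \<Longrightarrow> wfx (residueE a b)"
  "wfx a \<Longrightarrow> wfx b \<Longrightarrow> wfx (goodE a b)"
  "wfx a \<Longrightarrow> wfx (divE a)"
  "wfx a \<Longrightarrow> wfx (pickE a)"
  "wfx a \<Longrightarrow> wfx (amountE a)"
  "wfx a \<Longrightarrow> wfx (selectE a)"
  "wfx a \<Longrightarrow> wfx (outputE a)"
  by (simp_all add: cnE_def digitE_def reachE_def coreE_def validE_def weightE_def conflictE_def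
      residueE_def goodE_def divE_def pickE_def amountE_def selectE_def outputE_def)

section \<open>Values of the algorithm's expressions in memory\<close>

context items
begin

definition represents :: "state \<Rightarrow> bool" where
  "represents s \<longleftrightarrow> s ''n'' 0 = n \<and>
     (\<forall>u<n. \<forall>v<n. cn u v \<longleftrightarrow> u = v \<or> 0 < s ''adj'' (u * n + v))"

text \<open>The quotient table includes the index \<open>n ^ 4\<close>: a stack cell may hold this
  code for none, and digits are extracted from it all the same.\<close>

definition prepared :: "state \<Rightarrow> bool" where
  "prepared s \<longleftrightarrow> represents s \<and> s ''m'' 0 = n ^ 4 \<and> (\<forall>i\<le>n ^ 4. s ''q'' i = i div n)"

lemma truth_cnE:
  "prepared s \<Longrightarrow> xval a s \<rho> < n \<Longrightarrow> xval b s \<rho> < n \<Longrightarrow>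
    truth (cnE a b) s \<rho> \<longleftrightarrow> cn (xval a s \<rho>) (xval b s \<rho>)"
  unfolding cnE_def truth_simps truth_less
  by (simp add: prepared_def represents_def truth_def) linarith

text \<open>For \<open>n = 0\<close> the count would be \<open>e\<close>, whereas
  \<open>e div 0\<close> is 0. In that case the table consists of the entry 0 only, so the last
  assumption holds where it is used.\<close>

lemma xval_divE:
  assumes "1 \<notin> fv e" "s ''n'' 0 = n" "n = 0 \<Longrightarrow> xval e s \<rho> = 0"
  shows "xval (divE e) s \<rho> = xval e s \<rho> div n"
proof (cases "n = 0")
  case True
  then show ?thesis using assms by (simp add: divE_def)
next
  case False
  let ?e = "xval e s \<rho>"
  have "{..<?e} \<inter> {j. \<not> ?e < Suc j * n} = {..<?e div n}"
  proof -
    have iff: "\<not> ?e < Suc j * n \<longleftrightarrow> j < ?e div n" for j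
      using less_eq_div_iff_mult_less_eq[of n "Suc j" ?e] False
      by (simp only: not_less Suc_le_eq)
    have "j < ?e" if "j < ?e div n" for j using that div_le_dividend by (rule order_less_le_trans)
    then show ?thesis unfolding iff by blast
  qed
  moreover have "xval (divE e) s \<rho> = card ({..<?e} \<inter> {j. \<not> ?e < Suc j * n})"
    using assms unfolding divE_def xval.simps(7)[of 1] xval_xnot truth_less
    by (simp add: sum_of_bool_eq del: mult_Suc)
  ultimately show ?thesis by simp
qed

lemma xval_quotE:
  assumes "prepared s" "xval e s \<rho> \<le> n ^ 4"
  shows "xval (quotE k e) s \<rho> = xval e s \<rho> div n ^ k"
proof (induction k)
  case (Suc k)
  have "xval e s \<rho> div n ^ k \<le> n ^ 4" using assms(2) div_le_dividend order_trans by blast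
  then show ?case
    using Suc assms(1) by (simp add: quotE_def prepared_def mult.commute flip: div_mult2_eq)
qed (simp add: quotE_def)

lemma xval_digitE:
  assumes "prepared s" "xval e s \<rho> \<le> n ^ 4"
  shows "xval (digitE k e) s \<rho> = digit k (xval e s \<rho>)"
proof -
  let ?x = "xval e s \<rho>"
  have "xval (digitE k e) s \<rho> = ?x div n ^ k - ?x div n ^ Suc k * n"
    using assms xval_quotE[OF assms] by (simp add: digitE_def prepared_def represents_def del: power_Suc)
  also have "?x div n ^ Suc k = ?x div n ^ k div n" by (simp only: power_Suc2 div_mult2_eq)
  finally show ?thesis by (simp only: digit_def minus_div_mult_eq_mod)
qed

lemma truth_reachE:
  assumes "prepared s" "xval e s \<rho> \<le> n ^ 4" "xval x s \<rho> < n"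
  shows "truth (reachE e x) s \<rho> \<longleftrightarrow> reach (xval e s \<rho>) (xval x s \<rho>)"
proof -
  have "0 < n" using assms(3) by simp
  then show ?thesis unfolding reachE_def truth_simps reach_def
    using assms truth_cnE xval_digitE digit_less by simp
qed

text \<open>The conditions on \<open>fv\<close>, here and below, prevent capture when
  \<open>e\<close> and \<open>v\<close> are placed under the binders of the expression.\<close>

lemma truth_coreE:
  assumes "prepared s" "xval e s \<rho> \<le> n ^ 4" "xval v s \<rho> < n" "2 \<notin> fv e" "2 \<notin> fv v"
  shows "truth (coreE e v) s \<rho> \<longleftrightarrow> core (xval e s \<rho>) (xval v s \<rho>)"
proof -
  have n: "0 < n" "s ''n'' 0 = n" using assms by (auto simp: prepared_def represents_def)
  then show ?thesis unfolding coreE_def truth_simps core_def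
    using assms by (auto simp: truth_cnE truth_reachE xval_digitE digit_less)
qed

lemma truth_validE:
  assumes "prepared s" "xval e s \<rho> \<le> n ^ 4" "0 < n" "fv e \<inter> {2,3,4} = {}"
  shows "truth (validE e) s \<rho> \<longleftrightarrow> valid (xval e s \<rho>)"
proof -
  have n: "s ''n'' 0 = n" using assms by (auto simp: prepared_def represents_def)
  then show ?thesis unfolding validE_def truth_simps valid_def
    using assms by (auto simp: truth_cnE truth_coreE xval_digitE digit_less)
qed

lemma xval_weightE:
  assumes "prepared s" "xval e s \<rho> \<le> n ^ 4" "0 < n" "fv e \<inter> {2,3,4,5,99} = {}"
  shows "xval (weightE e) s \<rho> = weight (xval e s \<rho>)"
proof -
  have n: "s ''n'' 0 = n" using assms by (auto simp: prepared_def represents_def)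
  have "xval (XSum 5 nE (xbool (coreE e (XVar 5)))) s \<rho> =
      (\<Sum>i<n. of_bool (truth (coreE e (XVar 5)) s (\<rho>(5 := i))))"
    by (simp only: xval.simps(7) xval_xbool) (simp add: n)
  also have "\<dots> = (\<Sum>i<n. of_bool (core (xval e s \<rho>) i))"
    using assms by (intro sum.cong refl) (simp add: truth_coreE)
  also have "\<dots> = card {v. v < n \<and> core (xval e s \<rho>) v}"
    by (simp add: sum_of_bool_eq Int_def)
  finally have "xval (XSum 5 nE (xbool (coreE e (XVar 5)))) s \<rho> = card {v. v < n \<and> core (xval e s \<rho>) v}" .
  moreover have "truth (validE e) s \<rho> \<longleftrightarrow> valid (xval e s \<rho>)"
    using assms by (intro truth_validE) auto
  moreover have "99 \<notin> fv (XSum 5 nE (xbool (coreE e (XVar 5))))" using assms by simp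
  ultimately show ?thesis unfolding weightE_def weight_def by (subst xval_xif) simp_all
qed

lemma truth_conflictE:
  assumes "prepared s" "xval e s \<rho> \<le> n ^ 4" "xval f s \<rho> \<le> n ^ 4" "6 \<notin> fv e" "6 \<notin> fv f"
  shows "truth (conflictE e f) s \<rho> \<longleftrightarrow> conflict (xval e s \<rho>) (xval f s \<rho>)"
proof -
  have n: "s ''n'' 0 = n" using assms by (auto simp: prepared_def represents_def)
  then show ?thesis unfolding conflictE_def truth_simps conflict_def
    using assms by (auto simp: truth_reachE)
qed

definition residue :: "state \<Rightarrow> nat \<Rightarrow> nat \<Rightarrow> nat" where
  "residue s t j = weight j - (\<Sum>i<t. if conflict (s ''stk'' i) j then s ''eps'' i else 0)"

definition good :: "state \<Rightarrow> nat \<Rightarrow> nat \<Rightarrow> bool" where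
  "good s t i \<longleftrightarrow> 0 < residue s t i \<and> (\<forall>j<n ^ 4. \<forall>k<n ^ 4. 0 < residue s t j \<longrightarrow> 0 < residue s t k \<longrightarrow>
     conflict i j \<longrightarrow> conflict i k \<longrightarrow> conflict j k)"

definition pick :: "state \<Rightarrow> nat \<Rightarrow> nat" where
  "pick s t = card {i. i < n ^ 4 \<and> \<not> (\<exists>j\<le>i. good s t j)}"

lemma xval_residueE:
  assumes "prepared s" "xval j s \<rho> \<le> n ^ 4" "0 < n" "fv j \<inter> {2,3,4,5,6,7,99} = {}"
    "7 \<notin> fv t" "\<And>i. i < xval t s \<rho> \<Longrightarrow> s ''stk'' i \<le> n ^ 4"
  shows "xval (residueE t j) s \<rho> = residue s (xval t s \<rho>) (xval j s \<rho>)"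
proof -
  have "xval (xif (conflictE (XCell ''stk'' (XVar 7)) j) (XCell ''eps'' (XVar 7))) s (\<rho>(7 := i)) =
      (if conflict (s ''stk'' i) (xval j s \<rho>) then s ''eps'' i else 0)" if "i < xval t s \<rho>" for i
  proof -
    have "truth (conflictE (XCell ''stk'' (XVar 7)) j) s (\<rho>(7 := i)) \<longleftrightarrow>
        conflict (s ''stk'' i) (xval j s \<rho>)"
      using assms that by (subst truth_conflictE) auto
    moreover have "99 \<notin> fv (XCell ''eps'' (XVar 7))" by simp
    ultimately show ?thesis by (subst xval_xif) simp_all
  qed
  then have "xval (XSum 7 t (xif (conflictE (XCell ''stk'' (XVar 7)) j) (XCell ''eps'' (XVar 7)))) s \<rho> =
     (\<Sum>i<xval t s \<rho>. if conflict (s ''stk'' i) (xval j s \<rho>) then s ''eps'' i else 0)"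
    unfolding xval.simps(7)[of 7] by (intro sum.cong refl) simp
  moreover have "xval (weightE j) s \<rho> = weight (xval j s \<rho>)" using assms by (intro xval_weightE) auto
  ultimately show ?thesis unfolding residueE_def residue_def by (simp only: xval.simps(5))
qed

lemma truth_residueE:
  assumes "prepared s" "xval j s \<rho> \<le> n ^ 4" "0 < n" "fv j \<inter> {2,3,4,5,6,7,99} = {}"
    "7 \<notin> fv t" "\<And>i. i < xval t s \<rho> \<Longrightarrow> s ''stk'' i \<le> n ^ 4"
  shows "truth (residueE t j) s \<rho> \<longleftrightarrow> 0 < residue s (xval t s \<rho>) (xval j s \<rho>)"
proof -
  have "xval (residueE t j) s \<rho> = residue s (xval t s \<rho>) (xval j s \<rho>)"
    by (rule xval_residueE) (use assms in auto)
  then show ?thesis by (simp only: truth_def)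
qed

lemma truth_goodE:
  assumes "prepared s" "xval e s \<rho> \<le> n ^ 4" "0 < n" "fv e \<inter> {2,3,4,5,6,7,8,9,99} = {}"
    "fv t \<inter> {7,8,9} = {}" "\<And>i. i < xval t s \<rho> \<Longrightarrow> s ''stk'' i \<le> n ^ 4"
  shows "truth (goodE t e) s \<rho> \<longleftrightarrow> good s (xval t s \<rho>) (xval e s \<rho>)"
proof -
  have m: "s ''m'' 0 = n ^ 4" using assms by (auto simp: prepared_def)
  let ?t = "xval t s \<rho>" and ?e = "xval e s \<rho>"
  have res: "truth (residueE t e) s \<rho> \<longleftrightarrow> 0 < residue s ?t ?e"
    using assms by (intro truth_residueE) auto
  have "truth (ximp (residueE t (XVar 8)) (ximp (residueE t (XVar 9)) (ximp (conflictE e (XVar 8))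
       (ximp (conflictE e (XVar 9)) (conflictE (XVar 8) (XVar 9)))))) s (\<rho>(8 := j, 9 := k)) \<longleftrightarrow>
     (0 < residue s ?t j \<longrightarrow> 0 < residue s ?t k \<longrightarrow> conflict ?e j \<longrightarrow> conflict ?e k \<longrightarrow> conflict j k)"
    if "j < n ^ 4" "k < n ^ 4" for j k
  proof -
    let ?\<rho> = "\<rho>(8 := j, 9 := k)"
    have "truth (residueE t (XVar 8)) s ?\<rho> \<longleftrightarrow> 0 < residue s ?t j"
      "truth (residueE t (XVar 9)) s ?\<rho> \<longleftrightarrow> 0 < residue s ?t k"
      using assms that by (subst truth_residueE; auto)+
    moreover have "truth (conflictE e (XVar 8)) s ?\<rho> \<longleftrightarrow> conflict ?e j"
      "truth (conflictE e (XVar 9)) s ?\<rho> \<longleftrightarrow> conflict ?e k"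
      "truth (conflictE (XVar 8) (XVar 9)) s ?\<rho> \<longleftrightarrow> conflict j k"
      using assms that by (subst truth_conflictE; auto)+
    ultimately show ?thesis unfolding truth_simps by auto
  qed
  note body = this
  have M: "xval mE s \<rho>' = n ^ 4" for \<rho>' by (simp add: m)
  show ?thesis
    unfolding goodE_def good_def truth_xconj truth_xall res M using body by auto
qed

lemma xval_pickE:
  assumes "prepared s" "0 < n" "fv t \<inter> {7,8,9,10,11} = {}"
    "\<And>i. i < xval t s \<rho> \<Longrightarrow> s ''stk'' i \<le> n ^ 4"
  shows "xval (pickE t) s \<rho> = pick s (xval t s \<rho>)"
proof -
  have m: "s ''m'' 0 = n ^ 4" using assms by (auto simp: prepared_def)
  have "truth (XSum 11 (XAdd (XVar 10) (XLit 1)) (goodE t (XVar 11))) s (\<rho>(10 := i)) \<longleftrightarrow>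
      (\<exists>j\<le>i. good s (xval t s \<rho>) j)" if i: "i < n ^ 4" for i
  proof -
    have "truth (goodE t (XVar 11)) s (\<rho>(10 := i, 11 := j)) \<longleftrightarrow> good s (xval t s \<rho>) j" if "j \<le> i" for j
      using assms i that by (subst truth_goodE) auto
    then show ?thesis unfolding truth_simps by (auto simp: less_Suc_eq_le)
  qed
  then have "xval (pickE t) s \<rho> = (\<Sum>i<n ^ 4. of_bool (\<not> (\<exists>j\<le>i. good s (xval t s \<rho>) j)))"
    unfolding pickE_def xval.simps(7)[of 10] xval_xnot by (intro sum.cong) (simp_all add: m)
  also have "\<dots> = pick s (xval t s \<rho>)"
    unfolding pick_def by (simp add: sum_of_bool_eq Int_def del: not_ex)
  finally show ?thesis .
qed

lemma xval_amountE:
  assumes "prepared s" "0 < n" "fv t \<inter> {2,3,4,5,6,7,99} = {}"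
    "\<And>i. i \<le> xval t s \<rho> \<Longrightarrow> s ''stk'' i \<le> n ^ 4"
  shows "xval (amountE t) s \<rho> =
    (if s ''stk'' (xval t s \<rho>) < n ^ 4 then residue s (xval t s \<rho>) (s ''stk'' (xval t s \<rho>)) else 0)"
proof -
  have m: "s ''m'' 0 = n ^ 4" using assms by (auto simp: prepared_def)
  have "xval (residueE t (XCell ''stk'' t)) s (\<rho>(99 := i)) =
      residue s (xval t s \<rho>) (s ''stk'' (xval t s \<rho>))" for i
    using assms by (subst xval_residueE) auto
  then show ?thesis unfolding amountE_def xval.simps(7)[of 99] xval_xbool truth_less by (simp add: m)
qed

lemma xval_selectE:
  assumes "prepared s" "fv u \<inter> {6,12} = {}" "\<And>i. i < n ^ 4 \<Longrightarrow> s ''stk'' i \<le> n ^ 4"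
    "xval u s \<rho> < n ^ 4"
  shows "xval (selectE u) s \<rho> = of_bool (0 < s ''eps'' (n ^ 4 - Suc (xval u s \<rho>)) \<and>
    (\<forall>w<xval u s \<rho>. 0 < s ''sel'' w \<longrightarrow>
      \<not> conflict (s ''stk'' (n ^ 4 - Suc w)) (s ''stk'' (n ^ 4 - Suc (xval u s \<rho>)))))"
proof -
  have m: "s ''m'' 0 = n ^ 4" using assms by (auto simp: prepared_def)
  have "truth (conflictE (XCell ''stk'' (revE (XVar 12))) (XCell ''stk'' (revE u))) s (\<rho>(12 := w)) \<longleftrightarrow>
      conflict (s ''stk'' (n ^ 4 - Suc w)) (s ''stk'' (n ^ 4 - Suc (xval u s \<rho>)))"
    if "w < xval u s \<rho>" for w
    using assms that by (subst truth_conflictE) (auto simp: m)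
  moreover have "truth (XCell x e) s \<rho>' \<longleftrightarrow> 0 < s x (xval e s \<rho>')" for x e \<rho>'
    by (simp add: truth_def)
  ultimately show ?thesis unfolding selectE_def xval_xbool truth_simps
    by (auto simp: m)
qed

lemma xval_outputE:
  assumes "prepared s" "fv v \<inter> {2,13} = {}" "\<And>i. i < n ^ 4 \<Longrightarrow> s ''stk'' i \<le> n ^ 4" "xval v s \<rho> < n"
  shows "xval (outputE v) s \<rho> =
    of_bool (\<exists>u<n ^ 4. 0 < s ''sel'' u \<and> core (s ''stk'' (n ^ 4 - Suc u)) (xval v s \<rho>))"
proof -
  have m: "s ''m'' 0 = n ^ 4" using assms by (auto simp: prepared_def)
  have "truth (coreE (XCell ''stk'' (revE (XVar 13))) v) s (\<rho>(13 := u)) \<longleftrightarrow>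
      core (s ''stk'' (n ^ 4 - Suc u)) (xval v s \<rho>)" if "u < n ^ 4" for u
    using assms that by (subst truth_coreE) (auto simp: m)
  moreover have "truth (XCell x e) s \<rho>' \<longleftrightarrow> 0 < s x (xval e s \<rho>')" for x e \<rho>'
    by (simp add: truth_def)
  ultimately show ?thesis unfolding outputE_def xval_xbool truth_simps
    by (auto simp: m)
qed

end

section \<open>Loop invariants and their preservation\<close>

context items
begin

definition picked :: "state \<Rightarrow> nat \<Rightarrow> bool" where
  "picked s t \<longleftrightarrow> s ''stk'' t = pick s t \<and>
     s ''eps'' t = (if s ''stk'' t < n ^ 4 then residue s t (s ''stk'' t) else 0)"

definition selected :: "state \<Rightarrow> nat \<Rightarrow> bool" where
  "selected s u \<longleftrightarrow> 0 < s ''eps'' (n ^ 4 - Suc u) \<and> (\<forall>w<u. 0 < s ''sel'' w \<longrightarrow>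
     \<not> conflict (s ''stk'' (n ^ 4 - Suc w)) (s ''stk'' (n ^ 4 - Suc u)))"

definition output_set :: "state \<Rightarrow> nat set" where
  "output_set s = {v. v < n \<and> (\<exists>u<n ^ 4. 0 < s ''sel'' u \<and> core (s ''stk'' (n ^ 4 - Suc u)) v)}"

text \<open>The residual weights of round \<open>t\<close> read only the cells below
  \<open>t\<close>. This and the next two lemmas keep filled cells correct while later ones are
  written.\<close>

lemma residue_cong:
  assumes "\<And>i. i < t \<Longrightarrow> s ''stk'' i = s' ''stk'' i \<and> s ''eps'' i = s' ''eps'' i"
  shows "residue s t = residue s' t"
proof
  fix j
  have "(\<Sum>i<t. if conflict (s ''stk'' i) j then s ''eps'' i else 0) =
      (\<Sum>i<t. if conflict (s' ''stk'' i) j then s' ''eps'' i else 0)"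
    using assms by (intro sum.cong) auto
  then show "residue s t j = residue s' t j" by (simp only: residue_def)
qed

lemma pick_cong:
  assumes "\<And>i. i < t \<Longrightarrow> s ''stk'' i = s' ''stk'' i \<and> s ''eps'' i = s' ''eps'' i"
  shows "pick s t = pick s' t"
proof -
  have "residue s t = residue s' t" by (rule residue_cong) (use assms in auto)
  then show ?thesis by (simp add: pick_def good_def)
qed

lemma picked_cong:
  assumes "\<And>i. i \<le> t \<Longrightarrow> s ''stk'' i = s' ''stk'' i \<and> s ''eps'' i = s' ''eps'' i"
  shows "picked s t \<longleftrightarrow> picked s' t"
proof -
  have "residue s t = residue s' t" by (rule residue_cong) (use assms in auto)
  moreover have "pick s t = pick s' t" by (rule pick_cong) (use assms in auto)
  ultimately show ?thesis using assms[of t] by (simp add: picked_def)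
qed

lemma pick_le: "pick s t \<le> n ^ 4"
proof -
  have "pick s t \<le> card {..<n ^ 4}" unfolding pick_def by (rule card_mono) auto
  then show ?thesis by simp
qed

lemma picked_le: "picked s t \<Longrightarrow> s ''stk'' t \<le> n ^ 4"
  using pick_le by (simp add: picked_def)

lemma residue_le: "residue s t j \<le> n ^ 4"
proof -
  have "n \<le> n ^ 4" by (cases "n = 0") (simp_all add: self_le_power)
  then show ?thesis using weight_le[of j] by (simp add: residue_def)
qed

lemma pick_good:
  assumes "i < n ^ 4" "good s t i"
  shows "pick s t < n ^ 4" "good s t (pick s t)"
proof -
  define i0 where "i0 = (LEAST i. good s t i)"
  have i0: "good s t i0" "i0 \<le> i" and least: "\<And>j. good s t j \<Longrightarrow> i0 \<le> j"
    using assms(2) unfolding i0_def by (auto intro: LeastI Least_le)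
  have "{i. i < n ^ 4 \<and> \<not> (\<exists>j\<le>i. good s t j)} = {..<i0}"
  proof (intro set_eqI iffI)
    fix x assume "x \<in> {i. i < n ^ 4 \<and> \<not> (\<exists>j\<le>i. good s t j)}"
    then show "x \<in> {..<i0}" using i0(1) by (auto simp flip: not_le)
  next
    fix x assume x: "x \<in> {..<i0}"
    then have "\<not> good s t j" if "j \<le> x" for j using least[of j] that by auto
    then show "x \<in> {i. i < n ^ 4 \<and> \<not> (\<exists>j\<le>i. good s t j)}" using x i0(2) assms(1) by auto
  qed
  then have "pick s t = i0" by (simp add: pick_def)
  then show "pick s t < n ^ 4" "good s t (pick s t)" using i0 assms(1) by auto
qed

lemma pick_none:
  assumes "\<not> (\<exists>i<n ^ 4. good s t i)"
  shows "pick s t = n ^ 4"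
proof -
  have "{i. i < n ^ 4 \<and> \<not> (\<exists>j\<le>i. good s t j)} = {..<n ^ 4}"
    using assms by (auto dest: order_le_less_trans)
  then show ?thesis by (simp add: pick_def)
qed

lemma prepared_update [simp]:
  "x \<notin> {''n'', ''m'', ''adj'', ''q''} \<Longrightarrow> prepared (s(x := f)) = prepared s"
  by (auto simp: prepared_def represents_def)

lemma represents_update [simp]:
  "x \<notin> {''n'', ''adj''} \<Longrightarrow> represents (s(x := f)) = represents s"
  by (auto simp: represents_def)

text \<open>The states of the program before the filling of cell \<open>k\<close> in each of its loops.\<close>

definition inv_start :: "nat \<Rightarrow> nat \<Rightarrow> state \<Rightarrow> bool" where
  "inv_start k X s \<longleftrightarrow> n ^ 4 + 2 \<le> X \<and> represents s"

definition inv_quot :: "nat \<Rightarrow> nat \<Rightarrow> state \<Rightarrow> bool" where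
  "inv_quot k X s \<longleftrightarrow> inv_start k X s \<and> s ''m'' 0 = n ^ 4 \<and> (\<forall>i<k. s ''q'' i = i div n)"

definition inv_pick :: "nat \<Rightarrow> nat \<Rightarrow> state \<Rightarrow> bool" where
  "inv_pick k X s \<longleftrightarrow> n ^ 4 + 2 \<le> X \<and> prepared s \<and> (\<forall>t<k. picked s t)"

definition inv_select :: "nat \<Rightarrow> nat \<Rightarrow> state \<Rightarrow> bool" where
  "inv_select k X s \<longleftrightarrow> inv_pick (n ^ 4) X s \<and> (\<forall>u<k. 0 < s ''sel'' u \<longleftrightarrow> selected s u)"

definition inv_output :: "nat \<Rightarrow> nat \<Rightarrow> state \<Rightarrow> bool" where
  "inv_output k X s \<longleftrightarrow> inv_select (n ^ 4) X s \<and> (\<forall>v<k. s ''out'' v = of_bool (v \<in> output_set s))"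

lemma step_quot:
  assumes "inv_quot k X s" "k < n ^ 4 + 1"
  defines "v \<equiv> xval (divE (XVar 0)) s (counter k)"
  shows "v \<le> X \<and> inv_quot (Suc k) X (s(''q'' := (s ''q'')(k := v)))"
proof -
  have "s ''n'' 0 = n" "n ^ 4 + 2 \<le> X"
    using assms(1) by (auto simp: inv_quot_def inv_start_def represents_def)
  then have "v = k div n" unfolding v_def using assms(2) by (subst xval_divE) auto
  moreover have "k div n \<le> X"
    using div_le_dividend[of k n] assms(2) \<open>n ^ 4 + 2 \<le> X\<close> by linarith
  ultimately show ?thesis
    using assms(1) by (auto simp: inv_quot_def inv_start_def less_Suc_eq)
qed

text \<open>Half a round: \<open>picked\<close> holds for cell \<open>k\<close> only after
  \<open>step_amount\<close>, so the invariant stays at \<open>k\<close> and the new stack entry is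
  recorded separately.\<close>

lemma step_pick:
  assumes inv: "inv_pick k X s" and k: "k < n ^ 4"
  defines "v \<equiv> xval (pickE (XVar 0)) s (counter k)"
  shows "v \<le> X \<and> inv_pick k X (s(''stk'' := (s ''stk'')(k := v))) \<and> v = pick (s(''stk'' := (s ''stk'')(k := v))) k"
proof -
  let ?s = "s(''stk'' := (s ''stk'')(k := v))"
  have n: "0 < n" using k by (cases "n = 0") auto
  have prep: "prepared s" "n ^ 4 + 2 \<le> X" and le: "\<And>i. i < k \<Longrightarrow> s ''stk'' i \<le> n ^ 4"
    using inv picked_le by (auto simp: inv_pick_def)
  have "v = pick s k" unfolding v_def using prep n le by (subst xval_pickE) auto
  moreover have "pick s k = pick ?s k" by (rule pick_cong) auto
  moreover have "picked ?s t" if "t < k" for t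
    using picked_cong[of t ?s s] that inv by (auto simp: inv_pick_def)
  moreover have "v \<le> X" using calculation(1) pick_le[of s k] prep(2) by linarith
  ultimately show ?thesis using prep by (simp add: inv_pick_def)
qed

lemma step_amount:
  assumes inv: "inv_pick k X s" and k: "k < n ^ 4" and stk: "s ''stk'' k = pick s k"
  defines "v \<equiv> xval (amountE (XVar 0)) s (counter k)"
  shows "v \<le> X \<and> inv_pick (Suc k) X (s(''eps'' := (s ''eps'')(k := v)))"
proof -
  let ?s = "s(''eps'' := (s ''eps'')(k := v))"
  have n: "0 < n" using k by (cases "n = 0") auto
  have prep: "prepared s" "n ^ 4 + 2 \<le> X" using inv by (auto simp: inv_pick_def)
  have le: "s ''stk'' i \<le> n ^ 4" if "i \<le> k" for i
    using that inv picked_le pick_le stk by (cases "i = k") (auto simp: inv_pick_def)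
  have v: "v = (if s ''stk'' k < n ^ 4 then residue s k (s ''stk'' k) else 0)"
    unfolding v_def using prep n le by (subst xval_amountE) auto
  then have "v \<le> X" using residue_le[of s k "s ''stk'' k"] prep(2) by auto
  moreover have "picked ?s t" if "t < k" for t
    using picked_cong[of t ?s s] that inv by (auto simp: inv_pick_def)
  moreover have "picked ?s k"
  proof -
    define s' where "s' = ?s"
    have "pick s' k = pick s k" by (rule pick_cong) (auto simp: s'_def)
    moreover have "residue s' k = residue s k" by (rule residue_cong) (auto simp: s'_def)
    moreover have "s' ''stk'' k = s ''stk'' k" "s' ''eps'' k = v" by (simp_all add: s'_def)
    ultimately have "picked s' k" using stk v by (simp add: picked_def)
    then show ?thesis by (simp only: s'_def)
  qed
  ultimately show ?thesis using prep by (auto simp: inv_pick_def less_Suc_eq)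
qed

lemma step_select:
  assumes inv: "inv_select k X s" and k: "k < n ^ 4"
  defines "v \<equiv> xval (selectE (XVar 0)) s (counter k)"
  shows "v \<le> X \<and> inv_select (Suc k) X (s(''sel'' := (s ''sel'')(k := v)))"
proof -
  let ?s = "s(''sel'' := (s ''sel'')(k := v))"
  have prep: "prepared s" "n ^ 4 + 2 \<le> X" and le: "\<And>i. i < n ^ 4 \<Longrightarrow> s ''stk'' i \<le> n ^ 4"
    using inv picked_le by (auto simp: inv_pick_def inv_select_def)
  have v: "v = of_bool (selected s k)"
    unfolding v_def selected_def using prep le k by (subst xval_selectE) auto
  then have "v \<le> X" using prep(2) by (cases "selected s k") auto
  moreover have "selected ?s u \<longleftrightarrow> selected s u" if "u \<le> k" for u
    using that by (auto simp: selected_def)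
  moreover have "picked ?s t \<longleftrightarrow> picked s t" for t by (rule picked_cong) auto
  ultimately show ?thesis using inv v
    by (auto simp: inv_select_def inv_pick_def less_Suc_eq)
qed

lemma step_output:
  assumes inv: "inv_output k X s" and k: "k < n"
  defines "v \<equiv> xval (outputE (XVar 0)) s (counter k)"
  shows "v \<le> X \<and> inv_output (Suc k) X (s(''out'' := (s ''out'')(k := v)))"
proof -
  let ?s = "s(''out'' := (s ''out'')(k := v))"
  have prep: "prepared s" "n ^ 4 + 2 \<le> X" and le: "\<And>i. i < n ^ 4 \<Longrightarrow> s ''stk'' i \<le> n ^ 4"
    using inv picked_le by (auto simp: inv_pick_def inv_select_def inv_output_def)
  have v: "v = of_bool (k \<in> output_set s)"
    unfolding v_def output_set_def using prep le k by (subst xval_outputE) auto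
  then have "v \<le> X" using prep(2) by (cases "k \<in> output_set s") auto
  moreover have "selected ?s u \<longleftrightarrow> selected s u" for u by (simp add: selected_def)
  moreover have "output_set ?s = output_set s" by (simp add: output_set_def)
  moreover have "picked ?s t \<longleftrightarrow> picked s t" for t by (rule picked_cong) auto
  ultimately show ?thesis using inv v
    by (auto simp: inv_output_def inv_select_def inv_pick_def less_Suc_eq)
qed

end

section \<open>Correctness and running time of the whole program\<close>

type_synonym input = "nat \<times> (nat \<Rightarrow> nat \<Rightarrow> bool)"

definition on_input ::
    "(nat \<Rightarrow> (nat \<Rightarrow> nat \<Rightarrow> bool) \<Rightarrow> nat \<Rightarrow> nat \<Rightarrow> state \<Rightarrow> bool) \<Rightarrow> input \<Rightarrow> nat \<Rightarrow> nat \<Rightarrow> state \<Rightarrow> bool" where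
  "on_input I g = I (fst g) (snd g)"

lemma triple_fill:
  fixes I :: "nat \<Rightarrow> (nat \<Rightarrow> nat \<Rightarrow> bool) \<Rightarrow> nat \<Rightarrow> nat \<Rightarrow> state \<Rightarrow> bool"
  assumes wf: "wfx e" and x: "x \<noteq> ''t''" "x \<noteq> ''v''"
    and step: "\<And>n cn k X m. k < K n \<Longrightarrow> I n cn k X m \<Longrightarrow>
      xval e m (counter k) \<le> X \<and> I n cn (Suc k) X (m(x := (m x)(k := xval e m (counter k))))"
    and bound: "\<And>n cn k X s. I n cn k X (mem s) \<Longrightarrow> aval N s = K n \<and> K n \<le> X"
  shows "triple (\<lambda>g k X m. k = 0 \<and> on_input I g 0 X m) (forc N (setc x e))
    (\<lambda>g k X m. k = 0 \<and> on_input I g (K (fst g)) X m)"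
proof (rule triple_for)
  show "triple (\<lambda>g k X m. k < K (fst g) \<and> on_input I g k X m) (setc x e)
      (\<lambda>g k. on_input I g (Suc k))"
  proof (rule triple_set[OF wf x])
    fix g k X m assume "k < K (fst g) \<and> on_input I g k X m"
    then show "xval e m (counter k) \<le> X \<and>
        on_input I g (Suc k) X (m(x := (m x)(k := xval e m (counter k))))"
      using step unfolding on_input_def by blast
  qed
  show "aval N s = K (fst g) \<and> K (fst g) \<le> X" if "on_input I g k X (mem s)" for g k X s
    using bound that unfolding on_input_def by blast
qed

text \<open>The pair of \<open>n\<close> and \<open>cn\<close> is a ghost parameter, quantified
  after the exponent, so one exponent serves all graphs. The statement covers arbitrary
  \<open>cn\<close>; intervals matter only for the quality of the output.\<close>

lemma program_correct:
  "triple (\<lambda>g k X m. k = 0 \<and> on_input items.inv_start g k X m) program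
     (\<lambda>g k X m. k = 0 \<and> on_input items.inv_output g (fst g) X m)"
proof -
  have n4: "n \<le> n ^ 4" for n :: nat by (cases "n = 0") (simp_all add: self_le_power)
  have "triple (\<lambda>g k X m. k = 0 \<and> on_input items.inv_start g k X m)
      (setc ''m'' (xmul nE (xmul nE (xmul nE nE)))) (\<lambda>g k X m. k = 0 \<and> on_input items.inv_quot g 0 X m)"
    by (rule triple_set)
      (auto simp: on_input_def items.inv_start_def items.inv_quot_def items.represents_def
        eval_nat_numeral items.represents_update)
  moreover have "triple (\<lambda>g k X m. k = 0 \<and> on_input items.inv_quot g 0 X m)
      (forc (Add (Cell ''m'' (Lit 0)) (Lit 1)) (setc ''q'' (divE (XVar 0))))
      (\<lambda>g k X m. k = 0 \<and> on_input items.inv_quot g (fst g ^ 4 + 1) X m)"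
  proof (rule triple_fill[where K = "\<lambda>n. n ^ 4 + 1"])
    show "aval (Add (Cell ''m'' (Lit 0)) (Lit 1)) s = n ^ 4 + 1 \<and> n ^ 4 + 1 \<le> X"
      if "items.inv_quot n cn k X (mem s)" for n cn k X s
      using that by (auto simp: items.inv_quot_def items.inv_start_def mem_def)
  qed (simp_all only: wfx_exps wfx.simps items.step_quot, simp_all)
  moreover have "triple (\<lambda>g k X m. k = 0 \<and> on_input items.inv_quot g (fst g ^ 4 + 1) X m)
      (forc (Cell ''m'' (Lit 0)) (Seq (setc ''stk'' (pickE (XVar 0))) (setc ''eps'' (amountE (XVar 0)))))
      (\<lambda>g k X m. k = 0 \<and> on_input items.inv_select g 0 X m)"
  proof (rule triple_conseq)
    show "triple (\<lambda>g k X m. k = 0 \<and> on_input items.inv_pick g 0 X m)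
      (forc (Cell ''m'' (Lit 0)) (Seq (setc ''stk'' (pickE (XVar 0))) (setc ''eps'' (amountE (XVar 0)))))
      (\<lambda>g k X m. k = 0 \<and> on_input items.inv_pick g (fst g ^ 4) X m)"
    proof (rule triple_for)
      show "triple (\<lambda>g k X m. k < fst g ^ 4 \<and> on_input items.inv_pick g k X m)
        (Seq (setc ''stk'' (pickE (XVar 0))) (setc ''eps'' (amountE (XVar 0))))
        (\<lambda>g k. on_input items.inv_pick g (Suc k))"
      proof (rule triple_seq)
        let ?R = "\<lambda>g k X m. k < fst g ^ 4 \<and> on_input items.inv_pick g k X m \<and>
          m ''stk'' k = items.pick (fst g) (snd g) m k"
        show "triple (\<lambda>g k X m. k < fst g ^ 4 \<and> on_input items.inv_pick g k X m)
            (setc ''stk'' (pickE (XVar 0))) ?R"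
          by (rule triple_set) (use items.step_pick in \<open>auto simp: on_input_def wfx_exps\<close>)
        show "triple ?R (setc ''eps'' (amountE (XVar 0))) (\<lambda>g k. on_input items.inv_pick g (Suc k))"
          by (rule triple_set) (use items.step_amount in \<open>auto simp: on_input_def wfx_exps\<close>)
      qed
    qed (auto simp: on_input_def items.inv_pick_def items.prepared_def mem_def)
  qed (auto simp: on_input_def items.inv_quot_def items.inv_start_def items.inv_pick_def
      items.inv_select_def items.prepared_def)
  moreover have "triple (\<lambda>g k X m. k = 0 \<and> on_input items.inv_select g 0 X m)
      (forc (Cell ''m'' (Lit 0)) (setc ''sel'' (selectE (XVar 0))))
      (\<lambda>g k X m. k = 0 \<and> on_input items.inv_select g (fst g ^ 4) X m)"
  proof (rule triple_fill[where K = "\<lambda>n. n ^ 4"])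
    show "aval (Cell ''m'' (Lit 0)) s = n ^ 4 \<and> n ^ 4 \<le> X"
      if "items.inv_select n cn k X (mem s)" for n cn k X s
      using that by (auto simp: items.inv_select_def items.inv_pick_def items.prepared_def mem_def)
  qed (simp_all only: wfx_exps wfx.simps items.step_select, simp_all)
  moreover have "triple (\<lambda>g k X m. k = 0 \<and> on_input items.inv_select g (fst g ^ 4) X m)
      (forc (Cell ''n'' (Lit 0)) (setc ''out'' (outputE (XVar 0))))
      (\<lambda>g k X m. k = 0 \<and> on_input items.inv_output g (fst g) X m)"
  proof (rule triple_conseq)
    show "triple (\<lambda>g k X m. k = 0 \<and> on_input items.inv_output g 0 X m)
      (forc (Cell ''n'' (Lit 0)) (setc ''out'' (outputE (XVar 0))))
      (\<lambda>g k X m. k = 0 \<and> on_input items.inv_output g (fst g) X m)"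
    proof (rule triple_fill[where K = "\<lambda>n. n"])
      show "aval (Cell ''n'' (Lit 0)) s = n \<and> n \<le> X"
        if "items.inv_output n cn k X (mem s)" for n cn k X s
        using that n4[of n] by (auto simp: items.inv_output_def items.inv_select_def
            items.inv_pick_def items.prepared_def items.represents_def mem_def)
    qed (simp_all only: wfx_exps wfx.simps items.step_output, simp_all)
  qed (auto simp: on_input_def items.inv_output_def)
  ultimately show ?thesis unfolding program_def by (intro triple_seq)
qed

text \<open>Since \<open>''sel''\<close> is stored in reverse, the upward loop performs the
  selection from the top of the stack that \<open>local_ratio\<close> prescribes. \<open>rev\<close>
  says that reversal is an involution on indices.\<close>

lemma (in interval_model) output_maximum:
  assumes "inv_output n X s"
  shows "separated {v. v < n \<and> s ''out'' v = 1}"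
    "separated T \<Longrightarrow> card T \<le> card {v. v < n \<and> s ''out'' v = 1}"
proof -
  let ?sel = "\<lambda>p. 0 < s ''sel'' (n ^ 4 - Suc p)"
  have picked: "picked s t" if "t < n ^ 4" for t
    using assms that by (simp add: inv_output_def inv_select_def inv_pick_def)
  have rev: "n ^ 4 - Suc (n ^ 4 - Suc p) = p" if "p < n ^ 4" for p using that by simp
  have lr: "local_ratio (n ^ 4) weight conflict (s ''stk'') (s ''eps'') (residue s) (good s) ?sel"
  proof
    show "conflict i i" if "i < n ^ 4" for i
      using that by (intro conflict_refl) (cases "n = 0"; simp)
    show "s ''stk'' t < n ^ 4 \<and> good s t (s ''stk'' t)" if "t < n ^ 4" "\<exists>i<n ^ 4. good s t i" for t
      using that picked[of t] pick_good by (auto simp: picked_def)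
    show "n ^ 4 \<le> s ''stk'' t" if "t < n ^ 4" "\<not> (\<exists>i<n ^ 4. good s t i)" for t
      using that picked[of t] pick_none by (simp add: picked_def)
    show "s ''eps'' t = (if s ''stk'' t < n ^ 4 then residue s t (s ''stk'' t) else 0)"
      if "t < n ^ 4" for t
      using picked[OF that] by (simp add: picked_def)
    show "?sel p \<longleftrightarrow> 0 < s ''eps'' p \<and>
        (\<forall>q<n ^ 4. p < q \<longrightarrow> ?sel q \<longrightarrow> \<not> conflict (s ''stk'' q) (s ''stk'' p))" if p: "p < n ^ 4" for p
    proof -
      let ?u = "n ^ 4 - Suc p"
      have "?u < n ^ 4" using p by simp
      then have "?sel p \<longleftrightarrow> selected s ?u"
        using assms by (simp add: inv_output_def inv_select_def)
      also have "\<dots> \<longleftrightarrow> 0 < s ''eps'' p \<and> (\<forall>w<?u. 0 < s ''sel'' w \<longrightarrow>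
          \<not> conflict (s ''stk'' (n ^ 4 - Suc w)) (s ''stk'' p))"
        unfolding selected_def rev[OF p] ..
      also have "(\<forall>w<?u. 0 < s ''sel'' w \<longrightarrow> \<not> conflict (s ''stk'' (n ^ 4 - Suc w)) (s ''stk'' p)) \<longleftrightarrow>
          (\<forall>q<n ^ 4. p < q \<longrightarrow> ?sel q \<longrightarrow> \<not> conflict (s ''stk'' q) (s ''stk'' p))"
      proof (intro iffI allI impI)
        fix q assume *: "\<forall>w<?u. 0 < s ''sel'' w \<longrightarrow> \<not> conflict (s ''stk'' (n ^ 4 - Suc w)) (s ''stk'' p)"
          and q: "q < n ^ 4" "p < q" "?sel q"
        have "n ^ 4 - Suc q < ?u" using p q by simp
        with * q(3) have "\<not> conflict (s ''stk'' (n ^ 4 - Suc (n ^ 4 - Suc q))) (s ''stk'' p)" by blast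
        then show "\<not> conflict (s ''stk'' q) (s ''stk'' p)" by (simp only: rev[OF q(1)] not_False_eq_True)
      next
        fix w assume *: "\<forall>q<n ^ 4. p < q \<longrightarrow> ?sel q \<longrightarrow> \<not> conflict (s ''stk'' q) (s ''stk'' p)"
          and w: "w < ?u" "0 < s ''sel'' w"
        have "n ^ 4 - Suc w < n ^ 4" "p < n ^ 4 - Suc w" "w < n ^ 4" using w p by simp_all
        with * w(2) rev[of w] show "\<not> conflict (s ''stk'' (n ^ 4 - Suc w)) (s ''stk'' p)" by simp
      qed
      finally show ?thesis .
    qed
    show "good s t i \<longleftrightarrow> 0 < residue s t i \<and> (\<forall>j<n ^ 4. \<forall>k<n ^ 4. 0 < residue s t j \<longrightarrow>
        0 < residue s t k \<longrightarrow> conflict i j \<longrightarrow> conflict i k \<longrightarrow> conflict j k)" for t i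
      by (rule good_def)
    show "residue s t j = weight j - (\<Sum>i<t. if conflict (s ''stk'' i) j then s ''eps'' i else 0)" for t j
      by (rule residue_def)
  qed (rule conflict_sym conflict_simplicial; assumption)+
  have "v \<in> output_set s \<longleftrightarrow> v < n \<and> (\<exists>p<n ^ 4. ?sel p \<and> core (s ''stk'' p) v)" for v
  proof -
    have "(\<exists>u<n ^ 4. 0 < s ''sel'' u \<and> core (s ''stk'' (n ^ 4 - Suc u)) v) \<longleftrightarrow>
        (\<exists>p<n ^ 4. ?sel p \<and> core (s ''stk'' p) v)"
    proof
      assume "\<exists>u<n ^ 4. 0 < s ''sel'' u \<and> core (s ''stk'' (n ^ 4 - Suc u)) v"
      then obtain u where "u < n ^ 4" "0 < s ''sel'' u" "core (s ''stk'' (n ^ 4 - Suc u)) v" by blast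
      then show "\<exists>p<n ^ 4. ?sel p \<and> core (s ''stk'' p) v"
        using rev[of u] by (intro exI[of _ "n ^ 4 - Suc u"]) simp
    next
      assume "\<exists>p<n ^ 4. ?sel p \<and> core (s ''stk'' p) v"
      then obtain p where "p < n ^ 4" "?sel p" "core (s ''stk'' p) v" by blast
      then show "\<exists>u<n ^ 4. 0 < s ''sel'' u \<and> core (s ''stk'' (n ^ 4 - Suc u)) v"
        using rev[of p] by (intro exI[of _ "n ^ 4 - Suc p"]) simp
    qed
    then show ?thesis by (simp add: output_set_def)
  qed
  moreover have "s ''out'' v = 1 \<longleftrightarrow> v \<in> output_set s" if "v < n" for v
    using assms that by (simp add: inv_output_def)
  ultimately have S: "{v. v < n \<and> s ''out'' v = 1} = {v. v < n \<and> (\<exists>p<n ^ 4. ?sel p \<and> core (s ''stk'' p) v)}"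
    by blast
  show "separated {v. v < n \<and> s ''out'' v = 1}"
    "separated T \<Longrightarrow> card T \<le> card {v. v < n \<and> s ''out'' v = 1}"
    unfolding S using selection_maximum[OF lr] by blast+
qed

section \<open>Interval graphs\<close>

text \<open>The distance is an infimum of walk lengths, which are natural numbers: excluding the
  lengths 0, 1 and 2 makes 3 a lower bound. Disconnected vertices, with infimum infinity, are
  covered as well.\<close>

lemma graph_dist_eq_2_iff:
  assumes "pair_graph G" "u \<in> pverts G" "v \<in> pverts G"
  shows "graph_dist G u v = 2 \<longleftrightarrow>
    u \<noteq> v \<and> (u, v) \<notin> parcs G \<and> (\<exists>x. (u, x) \<in> parcs G \<and> (x, v) \<in> parcs G)"
proof -
  interpret pair_graph G by fact
  have dist: "graph_dist G u v = (INF p\<in>{p. awalk u p v}. ereal (length p))"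
  proof -
    have "awalk_cost (\<lambda>_. 1) p = length p" for p :: "('a \<times> 'a) list"
      by (induction p) simp_all
    then show ?thesis unfolding graph_dist_def \<mu>_def by simp
  qed
  have upper: "graph_dist G u v \<le> length p" if "awalk u p v" for p
    unfolding dist using that by (auto intro: INF_lower2)
  have lower: "m \<le> graph_dist G u v" if "\<And>p. awalk u p v \<Longrightarrow> m \<le> ereal (length p)" for m
    unfolding dist using that by (auto intro: INF_greatest)
  have 0: "awalk u p v \<Longrightarrow> length p = 0 \<Longrightarrow> u = v" for p
    by (auto simp: awalk_Nil_iff)
  have 1: "awalk u p v \<Longrightarrow> length p = 1 \<Longrightarrow> (u, v) \<in> parcs G" for p
    by (cases p) (auto simp: awalk_simps)
  have 2: "awalk u p v \<Longrightarrow> length p = 2 \<Longrightarrow> \<exists>x. (u, x) \<in> parcs G \<and> (x, v) \<in> parcs G" for p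
    by (cases p; cases "tl p") (auto simp: awalk_simps)
  show ?thesis
  proof
    assume d: "graph_dist G u v = 2"
    have "u \<noteq> v" using upper[of "[]"] d assms by (auto simp: awalk_Nil_iff)
    moreover have "(u, v) \<notin> parcs G"
    proof
      assume "(u, v) \<in> parcs G"
      then have "awalk u [(u, v)] v" using assms by (simp add: awalk_simps)
      from upper[OF this] d show False by simp
    qed
    moreover have "\<exists>x. (u, x) \<in> parcs G \<and> (x, v) \<in> parcs G"
    proof (rule ccontr)
      assume no: "\<not> ?thesis"
      have "3 \<le> graph_dist G u v"
      proof (rule lower)
        fix p assume p: "awalk u p v"
        then have "length p \<noteq> 0" "length p \<noteq> 1" "length p \<noteq> 2"
          using 0[OF p] 1[OF p] 2[OF p] calculation no by blast+
        then have "3 \<le> length p" by linarith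
        then show "3 \<le> ereal (length p)" by simp
      qed
      with d show False by simp
    qed
    ultimately show "u \<noteq> v \<and> (u, v) \<notin> parcs G \<and> (\<exists>x. (u, x) \<in> parcs G \<and> (x, v) \<in> parcs G)"
      by blast
  next
    assume *: "u \<noteq> v \<and> (u, v) \<notin> parcs G \<and> (\<exists>x. (u, x) \<in> parcs G \<and> (x, v) \<in> parcs G)"
    then obtain x where "(u, x) \<in> parcs G" "(x, v) \<in> parcs G" by blast
    then have "awalk u [(u, x), (x, v)] v" using assms by (simp add: awalk_simps)
    from upper[OF this] have "graph_dist G u v \<le> 2" by simp
    moreover have "2 \<le> graph_dist G u v"
    proof (rule lower)
      fix p assume p: "awalk u p v"
      then have "length p \<noteq> 0" "length p \<noteq> 1" using 0[OF p] 1[OF p] * by blast+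
      then have "2 \<le> length p" by linarith
      then show "2 \<le> ereal (length p)" by simp
    qed
    ultimately show "graph_dist G u v = 2" by (rule antisym)
  qed
qed

definition closed_nbr :: "'a pair_pre_digraph \<Rightarrow> 'a \<Rightarrow> 'a \<Rightarrow> bool" where
  "closed_nbr G u v \<longleftrightarrow> u = v \<or> (u, v) \<in> parcs G"

lemma separated_cluster_iff:
  assumes "pair_graph G" "pverts G = {..<n}"
  shows "separated_cluster G S \<longleftrightarrow> items.separated n (closed_nbr G) S"
proof -
  interpret pair_graph G by fact
  have sym: "(u, v) \<in> parcs G \<longleftrightarrow> (v, u) \<in> parcs G" for u v
    using pair_sym_arcs by (auto simp: symmetric_def dest: symD)
  have verts: "u < n" "v < n" if "(u, v) \<in> parcs G" for u v
    using arc_fst_in_verts[OF that] arc_snd_in_verts[OF that] assms(2) by auto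
  have eq: "graph_dist G u v \<noteq> 2 \<longleftrightarrow>
      closed_nbr G u v \<or> \<not> (\<exists>x<n. closed_nbr G u x \<and> closed_nbr G v x)" if "u < n" "v < n" for u v
    using that assms graph_dist_eq_2_iff[OF assms(1), of u v] sym verts
    unfolding closed_nbr_def by (auto; blast)
  show ?thesis unfolding separated_cluster_def items.separated_def assms(2)
  proof (rule conj_cong[OF refl])
    assume S: "S \<subseteq> {..<n}"
    show "(\<forall>u\<in>S. \<forall>v\<in>S. graph_dist G u v \<noteq> 2) \<longleftrightarrow>
        (\<forall>u\<in>S. \<forall>v\<in>S. closed_nbr G u v \<or> \<not> (\<exists>x<n. closed_nbr G u x \<and> closed_nbr G v x))"
      by (intro ball_cong refl eq) (use S in auto)
  qed
qed

text \<open>Intervals may be open or unbounded. Choose a point in every nonempty pairwise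
  intersection and shrink each interval to the closed hull of its own chosen points. Old
  intersections survive through these points, and no new ones arise because the hull lies inside the
  interval.\<close>

lemma interval_graph_model:
  assumes "interval_graph G" "pverts G = {..<n}"
  obtains l r where "interval_model n (closed_nbr G) l r"
proof -
  let ?cn = "closed_nbr G"
  obtain I :: "nat \<Rightarrow> real set" where I: "\<And>v. v < n \<Longrightarrow> is_interval (I v) \<and> I v \<noteq> {}"
    "\<And>u v. u < n \<Longrightarrow> v < n \<Longrightarrow> u \<noteq> v \<Longrightarrow> (u, v) \<in> parcs G \<longleftrightarrow> I u \<inter> I v \<noteq> {}"
  proof -
    obtain I :: "nat \<Rightarrow> real set" where "\<forall>v\<in>{..<n}. is_interval (I v) \<and> I v \<noteq> {}"
      "\<forall>u\<in>{..<n}. \<forall>v\<in>{..<n}. u \<noteq> v \<longrightarrow> ((u, v) \<in> parcs G \<longleftrightarrow> I u \<inter> I v \<noteq> {})"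
      using assms(1) unfolding interval_graph_def assms(2) by blast
    then show thesis by (intro that[of I]) auto
  qed
  have cn: "?cn u v \<longleftrightarrow> I u \<inter> I v \<noteq> {}" if "u < n" "v < n" for u v
    using I that by (auto simp: closed_nbr_def)
  define p where "p u v = (SOME x. x \<in> I u \<inter> I v)" for u v
  have p: "p u v \<in> I u" "p u v \<in> I v" if "u < n" "v < n" "?cn u v" for u v
    using someI_ex[of "\<lambda>x. x \<in> I u \<inter> I v"] cn that unfolding p_def by blast+
  \<comment> \<open>Both hulls must contain the same point, and \<open>SOME\<close> picks it from
    the same set in either order.\<close>
  have p_sym: "p u v = p v u" for u v unfolding p_def by (simp only: Int_commute)
  define P where "P v = p v ` {u. u < n \<and> ?cn v u}" for v
  have fin: "finite (P v)" for v by (simp add: P_def)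
  have mem: "p v u \<in> P v" if "u < n" "?cn v u" for u v using that by (simp add: P_def)
  have ne: "P v \<noteq> {}" if "v < n" for v using mem[of v v] that by (auto simp: closed_nbr_def)
  have sub: "P v \<subseteq> I v" if "v < n" for v using p that by (auto simp: P_def)
  define l where "l v = Min (P v)" for v
  define r where "r v = Max (P v)" for v
  have lr: "l v \<in> I v" "r v \<in> I v" if "v < n" for v
    using sub[OF that] Min_in[OF fin ne[OF that]] Max_in[OF fin ne[OF that]]
    unfolding l_def r_def by blast+
  have between: "x \<in> I v" if "v < n" "l v \<le> x" "x \<le> r v" for v x
    using I(1)[OF that(1)] lr[OF that(1)] that(2,3) by (meson mem_is_interval_1_I)
  show ?thesis
  proof (rule that, unfold_locales)
    fix v assume "v < n"
    then show "l v \<le> r v" unfolding l_def r_def using fin ne by (meson Max_ge Min_in)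
  next
    fix u v assume uv: "u < n" "v < n"
    show "?cn u v \<longleftrightarrow> l u \<le> r v \<and> l v \<le> r u"
    proof
      assume "?cn u v"
      then have "?cn v u" using cn uv by blast
      have "p u v \<in> P u" "p u v \<in> P v"
        using mem[OF uv(2) \<open>?cn u v\<close>] mem[OF uv(1) \<open>?cn v u\<close>] p_sym by simp_all
      then have "l u \<le> p u v" "p u v \<le> r v" "l v \<le> p u v" "p u v \<le> r u"
        unfolding l_def r_def using fin by simp_all
      then show "l u \<le> r v \<and> l v \<le> r u" by linarith
    next
      assume *: "l u \<le> r v \<and> l v \<le> r u"
      have le: "l u \<le> r u" "l v \<le> r v"
        using uv unfolding l_def r_def by (meson fin ne Max_ge Min_in)+
      have "max (l u) (l v) \<in> I u" "max (l u) (l v) \<in> I v"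
        using * le uv by (intro between; simp)+
      then show "?cn u v" using cn uv by blast
    qed
  qed
qed

theorem theorem6:
  shows "\<exists>(c :: com) (p :: nat poly). \<forall>(n :: nat) (G :: nat pair_pre_digraph).
    interval_graph G \<and> pverts G = {..<n} \<longrightarrow>
    (\<exists>t s. exec c (graph_input G) t s \<and> t \<le> poly p n \<and>
           maximum_separated_cluster G (vertex_set_output G s))"
proof -
  obtain d where d: "\<And>g k X s. 2 \<le> X \<Longrightarrow> k = 0 \<and> on_input items.inv_start g k X (mem s) \<Longrightarrow>
      s ''v'' = counter k \<Longrightarrow> bounded_state X s \<Longrightarrow>
      \<exists>t s'. exec program s t s' \<and> t \<le> X ^ d \<and> (k = 0 \<and> on_input items.inv_output g (fst g) X (mem s')) \<and>
        s' ''v'' = counter k \<and> bounded_state X s'"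
    using program_correct unfolding triple_def by blast
  \<comment> \<open>\<open>[:2, 1:]\<close> is the polynomial \<open>x + 2\<close>, so this bound is
    \<open>X ^ d\<close> for \<open>X = (n + 2) ^ 4\<close>.\<close>
  have "\<exists>t s. exec program (graph_input G) t s \<and> t \<le> poly ([:2, 1:] ^ (4 * d)) n \<and>
      maximum_separated_cluster G (vertex_set_output G s)"
    if G: "interval_graph G" "pverts G = {..<n}" for n and G :: "nat pair_pre_digraph"
  proof -
    \<comment> \<open>Bounds all stored numbers, among them the code \<open>n ^ 4\<close> for none
      and the counter, which reaches \<open>n ^ 4 + 1\<close>; it is at least 2 even for the empty
      graph.\<close>
    let ?X = "(n + 2) ^ 4"
    let ?s = "graph_input G"
    have pg: "pair_graph G" using G(1) by (simp add: interval_graph_def)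
    have card: "card (pverts G) = n" using G(2) by simp
    have X: "n ^ 4 + 2 \<le> ?X" "n \<le> ?X"
      by (simp_all add: eval_nat_numeral algebra_simps)
    have "bounded_state ?X ?s"
      using X by (auto simp: bounded_state_def graph_input_def card Let_def)
    moreover have "?s ''v'' = counter 0" by (auto simp: graph_input_def Let_def)
    moreover have "on_input items.inv_start (n, closed_nbr G) 0 ?X (mem ?s)"
    proof -
      have "closed_nbr G u v \<longleftrightarrow> u = v \<or> 0 < mem ?s ''adj'' (u * n + v)" if "u < n" "v < n" for u v
      proof -
        have "u * n + v < Suc u * n" using that by simp
        also have "\<dots> \<le> n * n" using that by (intro mult_le_mono1) simp
        finally have "u * n + v < n * n" .
        then show ?thesis
          using that by (simp add: closed_nbr_def mem_def graph_input_def card Let_def)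
      qed
      moreover have "mem ?s ''n'' 0 = n" by (simp add: mem_def graph_input_def card Let_def)
      ultimately show ?thesis
        using X(1) by (simp add: on_input_def items.inv_start_def items.represents_def)
    qed
    ultimately obtain t s where run: "exec program ?s t s" "t \<le> ?X ^ d"
      "items.inv_output n (closed_nbr G) n ?X (mem s)"
      using d[of ?X 0 "(n, closed_nbr G)" ?s] X(1) by (auto simp: on_input_def)
    have out: "vertex_set_output G s = {v. v < n \<and> mem s ''out'' v = 1}"
      using G(2) by (auto simp: vertex_set_output_def mem_def)
    obtain l r where "interval_model n (closed_nbr G) l r" using interval_graph_model[OF G] .
    then interpret interval_model n "closed_nbr G" l r .
    have "maximum_separated_cluster G (vertex_set_output G s)"
      unfolding maximum_separated_cluster_def separated_cluster_iff[OF pg G(2)] out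
      using output_maximum[OF run(3)] by blast
    moreover have "poly ([:2, 1:] ^ (4 * d)) n = ?X ^ d"
      by (simp add: poly_power power_mult add.commute)
    ultimately show ?thesis using run by auto
  qed
  then show ?thesis by blast
qed

end
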